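(* The birestriction $U_{\mathrm{R}}\colon\mathsf{RCCat}_{\mathrm{full}}\to\mathsf{Cat}_{\mathrm{full}}$ of the forgetful functor is a (Grothendieck) fibration, and the forgetful functor $U_{\mathrm{G}}\colon\mathsf{GCCat}\to\mathsf{Cat}$ is a bifibration. Moreover, the restriction $(\cdot)^{\natural}\colon\mathsf{RCCat}_{\mathrm{full}}\to\mathsf{GCCat}$, together with the canonical embedding $\mathrm{In}_{\mathsf{Cat}_{\mathrm{full}},\mathsf{Cat}}$ of $\mathsf{Cat}_{\mathrm{full}}$ into $\mathsf{Cat}$, is a morphism of fibrations from $U_{\mathrm{R}}$ to $U_{\mathrm{G}}$.
   Context: A Riguet congruence on a category $\mathsf{C}$ is a pair $\Phi=(\Phi^{\mathrm{ob}},\Phi^{\mathrm{fl}})$ where $\Phi^{\mathrm{ob}}$ is an equivalence relation on $\mathrm{Ob}(\mathsf{C})$ and $\Phi^{\mathrm{fl}}$ assigns to all $(a,a'),(b,b')\in\Phi^{\mathrm{ob}}$ a subset $\Phi^{\mathrm{fl}}_{\left(\begin{smallmatrix}a&b\\ a'&b'\end{smallmatrix}\right)}\subseteq\mathrm{Hom}_{\mathsf{C}}(a,b)\times\mathrm{Hom}_{\mathsf{C}}(a',b')$ such that: (Ra) if $(a,b)\in\Phi^{\mathrm{ob}}$, then $(\mathrm{id}_a,\mathrm{id}_b)\in\Phi^{\mathrm{fl}}_{\left(\begin{smallmatrix}a&a\\ b&b\end{smallmatrix}\right)}$; (Rb) if $f\in\mathrm{Hom}_{\mathsf{C}}(a,b)$,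 then $(f,f)\in\Phi^{\mathrm{fl}}_{\left(\begin{smallmatrix}a&b\\ a&b\end{smallmatrix}\right)}$; (Rc) if $(f,f')\in\Phi^{\mathrm{fl}}_{\left(\begin{smallmatrix}a&b\\ a'&b'\end{smallmatrix}\right)}$, then $(f',f)\in\Phi^{\mathrm{fl}}_{\left(\begin{smallmatrix}a'&b'\\ a&b\end{smallmatrix}\right)}$; (Rd) if $(f,f')\in\Phi^{\mathrm{fl}}_{\left(\begin{smallmatrix}a&b\\ a'&b'\end{smallmatrix}\right)}$ and $(f',f'')\in\Phi^{\mathrm{fl}}_{\left(\begin{smallmatrix}a'&b'\\ a''&b''\end{smallmatrix}\right)}$, then $(f,f'')\in\Phi^{\mathrm{fl}}_{\left(\begin{smallmatrix}a&b\\ a''&b''\end{smallmatrix}\right)}$; (Re) if $(f,f')\in\Phi^{\mathrm{fl}}_{\left(\begin{smallmatrix}a&b\\ a'&b'\end{smallmatrix}\right)}$ and $(g,g')\in\Phi^{\mathrm{fl}}_{\left(\begin{smallmatrix}b&c\\ b'&c'\end{smallmatrix}\right)}$, then $(g\circ f,g'\circ f')\in\Phi^{\mathrm{fl}}_{\left(\begin{smallmatrix}a&c\\ a'&c'\end{smallmatrix}\right)}$; (Rf) for all $(a,a'),(b,b')\in\Phi^{\mathrm{ob}}$ and $f\in\mathrm{Hom}_{\mathsf{C}}(a,b)$ there is $f'\in\mathrm{Hom}_{\mathsf{C}}(a',b')$ with $(f,f')\in\Phi^{\mathrm{fl}}_{\left(\begin{smallmatrix}a&b\\ a'&b'\end{smallmatrix}\right)}$.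 Let $\mathrm{sc}(f)$, $\mathrm{tg}(f)$ be source and target, $\mathrm{Mor}(\mathsf{C})^{+}$ the set of finite nonempty sequences of morphisms of $\mathsf{C}$, $(f)$ the length-one sequence, $\curlywedge$ concatenation; for an equivalence relation $E$ on $\mathrm{Ob}(\mathsf{C})$, $\mathrm{Mor}(\mathsf{C})^{+}_{E}$ is the set of $(f_i)_{i\in m}$ with $(\mathrm{tg}(f_i),\mathrm{sc}(f_{i+1}))\in E$ for every $i\in m-1$. A generalized congruence on $\mathsf{C}$ is a pair $\Psi=(\Psi^{\mathrm{ob}},\Psi^{\mathrm{fl}})$ where $\Psi^{\mathrm{ob}}$ is an equivalence relation on $\mathrm{Ob}(\mathsf{C})$ and $\Psi^{\mathrm{fl}}$ is an equivalence relation on $\mathrm{Mor}(\mathsf{C})^{+}_{\Psi^{\mathrm{ob}}}$ such that: (a) if $(a,b)\in\Psi^{\mathrm{ob}}$, then $((\mathrm{id}_a),(\mathrm{id}_b))\in\Psi^{\mathrm{fl}}$; (b) if $((f_i)_{i\in m},(g_j)_{j\in n})\in\Psi^{\mathrm{fl}}$, then $(\mathrm{sc}(f_0),\mathrm{sc}(g_0))\in\Psi^{\mathrm{ob}}$ and $(\mathrm{tg}(f_{m-1}),\mathrm{tg}(g_{n-1}))\in\Psi^{\mathrm{ob}}$; (c) if $\mathrm{sc}(g)=\mathrm{tg}(f)$, then $((f,g),(g\circ f))\in\Psi^{\mathrm{fl}}$; (d) if $((f_i)_{i\in m},(f'_{i'})_{i'\in m'}),((g_j)_{j\in n},(g'_{j'})_{j'\in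 n'})\in\Psi^{\mathrm{fl}}$ and $(\mathrm{tg}(f_{m-1}),\mathrm{sc}(g_0))\in\Psi^{\mathrm{ob}}$, then $((f_i)_{i\in m}\curlywedge(g_j)_{j\in n},(f'_{i'})_{i'\in m'}\curlywedge(g'_{j'})_{j'\in n'})\in\Psi^{\mathrm{fl}}$. For a Riguet congruence $\Phi$ on $\mathsf{C}$, $\Phi^{\natural}$ is the smallest (coordinatewise) generalized congruence $\Psi$ on $\mathsf{C}$ with $\Phi^{\mathrm{ob}}\subseteq\Psi^{\mathrm{ob}}$ and $((f),(f'))\in\Psi^{\mathrm{fl}}$ whenever $(f,f')$ lies in some component of $\Phi^{\mathrm{fl}}$; its object part is $\Phi^{\mathrm{ob}}$. $\mathsf{Cat}$ is the category of $\mathbf{U}$-categories ($\mathbf{U}$ a fixed Grothendieck universe) and functors; $\mathsf{Cat}_{\mathrm{full}}$ is its wide subcategory whose morphisms are the full functors. $\mathsf{RCCat}$ has as objects the pairs $(\mathsf{C},\Phi)$ with $\Phi$ a Riguet congruence on $\mathsf{C}$ and as morphisms $(\mathsf{C},\Phi)\to(\mathsf{D},\Upsilon)$ the functors $F\colon\mathsf{C}\to\mathsf{D}$ such that $(a,b)\in\Phi^{\mathrm{ob}}$ implies $(F(a),F(b))\in\Upsilon^{\mathrm{ob}}$ and $(f,f')\in\Phi^{\mathrm{fl}}_{\left(\begin{smallmatrix}a&b\\ a'&b'\end{smallmatrix}\right)}$ implies $(F(f),F(f'))\in\Upsilon^{\mathrm{fl}}_{\left(\begin{smallmatrix}F(a)&F(b)\\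 F(a')&F(b')\end{smallmatrix}\right)}$; $\mathsf{RCCat}_{\mathrm{full}}$ is its wide subcategory of those morphisms which are full functors. $\mathsf{GCCat}$ has as objects the pairs $(\mathsf{C},\Psi)$ with $\Psi$ a generalized congruence on $\mathsf{C}$ and as morphisms $(\mathsf{C},\Psi)\to(\mathsf{D},\Omega)$ the functors sending $\Psi^{\mathrm{ob}}$-related objects to $\Omega^{\mathrm{ob}}$-related objects and, applied termwise, $\Psi^{\mathrm{fl}}$-related sequences to $\Omega^{\mathrm{fl}}$-related sequences. $U_{\mathrm{R}}$ and $U_{\mathrm{G}}$ send a pair to its underlying category. The functor $(\cdot)^{\natural}$ sends $(\mathsf{C},\Phi)$ to $(\mathsf{C},\Phi^{\natural})$ and $F$ to $F$. A bifibration is a functor that is both a fibration and an opfibration. A morphism of fibrations from $p\colon\mathsf{E}\to\mathsf{B}$ to $q\colon\mathsf{E}'\to\mathsf{B}'$ is a pair of functors $(H\colon\mathsf{E}\to\mathsf{E}',K\colon\mathsf{B}\to\mathsf{B}')$ with $q\circ H=K\circ p$ such that $H$ sends $p$-cartesian morphisms to $q$-cartesian morphisms. *)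

theory Defs
  imports Main "HOL-Library.FuncSet"
begin

section \<open>Categories and functors\<close>

text \<open>
  All operations of a category, and both components of a functor, take the value
  \<^term>\<open>undefined\<close> outside their domain, so that equality of categories and of functors
  is the set-theoretic one. This matters because categories and functors are themselves the
  objects and morphisms of the category of categories below.
  The composite \<open>g \<circ> f\<close> is written \<open>cmp C g f\<close>.
\<close>

record ('o, 'm) category =
  Ob :: "'o set"
  Mor :: "'m set"
  sc :: "'m \<Rightarrow> 'o"
  tg :: "'m \<Rightarrow> 'o"
  idn :: "'o \<Rightarrow> 'm"
  cmp :: "'m \<Rightarrow> 'm \<Rightarrow> 'm"

definition Hom :: "('o, 'm) category \<Rightarrow> 'o \<Rightarrow> 'o \<Rightarrow> 'm set" where
  "Hom C a b = {f \<in> Mor C. sc C f = a \<and> tg C f = b}"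

definition is_category :: "('o, 'm) category \<Rightarrow> bool" where
  "is_category C \<longleftrightarrow>
     sc C \<in> Mor C \<rightarrow>\<^sub>E Ob C \<and>
     tg C \<in> Mor C \<rightarrow>\<^sub>E Ob C \<and>
     idn C \<in> extensional (Ob C) \<and>
     (\<forall>a \<in> Ob C. idn C a \<in> Hom C a a) \<and>
     (\<forall>g f. \<not> (f \<in> Mor C \<and> g \<in> Mor C \<and> tg C f = sc C g) \<longrightarrow> cmp C g f = undefined) \<and>
     (\<forall>f \<in> Mor C. \<forall>g \<in> Mor C. tg C f = sc C g \<longrightarrow> cmp C g f \<in> Hom C (sc C f) (tg C g)) \<and>
     (\<forall>f \<in> Mor C. cmp C f (idn C (sc C f)) = f \<and> cmp C (idn C (tg C f)) f = f) \<and>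
     (\<forall>f \<in> Mor C. \<forall>g \<in> Mor C. \<forall>h \<in> Mor C. tg C f = sc C g \<and> tg C g = sc C h \<longrightarrow>
        cmp C h (cmp C g f) = cmp C (cmp C h g) f)"

definition mk_category ::
  "'o set \<Rightarrow> 'm set \<Rightarrow> ('m \<Rightarrow> 'o) \<Rightarrow> ('m \<Rightarrow> 'o) \<Rightarrow> ('o \<Rightarrow> 'm) \<Rightarrow> ('m \<Rightarrow> 'm \<Rightarrow> 'm)
     \<Rightarrow> ('o, 'm) category" where
  "mk_category A M s t i c =
     \<lparr> Ob = A, Mor = M, sc = restrict s M, tg = restrict t M, idn = restrict i A,
       cmp = (\<lambda>g f. if f \<in> M \<and> g \<in> M \<and> t f = s g then c g f else undefined) \<rparr>"

definition wide_subcategory :: "('o, 'm) category \<Rightarrow> ('m \<Rightarrow> bool) \<Rightarrow> ('o, 'm) category" where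
  "wide_subcategory C P =
     mk_category (Ob C) {f \<in> Mor C. P f} (sc C) (tg C) (idn C) (cmp C)"

record ('o, 'm, 'p, 'n) cat_functor =
  Src :: "('o, 'm) category"
  Tgt :: "('p, 'n) category"
  omap :: "'o \<Rightarrow> 'p"
  amap :: "'m \<Rightarrow> 'n"

definition is_functor :: "('o, 'm, 'p, 'n) cat_functor \<Rightarrow> bool" where
  "is_functor F \<longleftrightarrow>
     is_category (Src F) \<and> is_category (Tgt F) \<and>
     omap F \<in> Ob (Src F) \<rightarrow>\<^sub>E Ob (Tgt F) \<and>
     amap F \<in> extensional (Mor (Src F)) \<and>
     (\<forall>f \<in> Mor (Src F).
        amap F f \<in> Hom (Tgt F) (omap F (sc (Src F) f)) (omap F (tg (Src F) f))) \<and>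
     (\<forall>a \<in> Ob (Src F). amap F (idn (Src F) a) = idn (Tgt F) (omap F a)) \<and>
     (\<forall>f \<in> Mor (Src F). \<forall>g \<in> Mor (Src F). tg (Src F) f = sc (Src F) g \<longrightarrow>
        amap F (cmp (Src F) g f) = cmp (Tgt F) (amap F g) (amap F f))"

definition mk_functor ::
  "('o, 'm) category \<Rightarrow> ('p, 'n) category \<Rightarrow> ('o \<Rightarrow> 'p) \<Rightarrow> ('m \<Rightarrow> 'n)
     \<Rightarrow> ('o, 'm, 'p, 'n) cat_functor" where
  "mk_functor C D h k =
     \<lparr> Src = C, Tgt = D, omap = restrict h (Ob C), amap = restrict k (Mor C) \<rparr>"

definition embedding :: "('o, 'm) category \<Rightarrow> ('o, 'm) category \<Rightarrow> ('o, 'm, 'o, 'm) cat_functor" where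
  "embedding C D = mk_functor C D (\<lambda>a. a) (\<lambda>f. f)"

definition id_functor :: "('o, 'm) category \<Rightarrow> ('o, 'm, 'o, 'm) cat_functor" where
  "id_functor C = embedding C C"

definition comp_functor ::
  "('p, 'n, 'q, 'r) cat_functor \<Rightarrow> ('o, 'm, 'p, 'n) cat_functor \<Rightarrow> ('o, 'm, 'q, 'r) cat_functor" where
  "comp_functor G F =
     mk_functor (Src F) (Tgt G) (\<lambda>a. omap G (omap F a)) (\<lambda>f. amap G (amap F f))"

definition birestriction ::
  "('o, 'm, 'p, 'n) cat_functor \<Rightarrow> ('o, 'm) category \<Rightarrow> ('p, 'n) category
     \<Rightarrow> ('o, 'm, 'p, 'n) cat_functor" where
  "birestriction F C D = mk_functor C D (omap F) (amap F)"

definition restriction ::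
  "('o, 'm, 'p, 'n) cat_functor \<Rightarrow> ('o, 'm) category \<Rightarrow> ('o, 'm, 'p, 'n) cat_functor" where
  "restriction F C = birestriction F C (Tgt F)"

definition is_full :: "('o, 'm, 'p, 'n) cat_functor \<Rightarrow> bool" where
  "is_full F \<longleftrightarrow>
     (\<forall>a \<in> Ob (Src F). \<forall>b \<in> Ob (Src F). \<forall>g \<in> Hom (Tgt F) (omap F a) (omap F b).
        \<exists>f \<in> Hom (Src F) a b. amap F f = g)"


section \<open>Fibrations\<close>

definition cartesian :: "('o, 'm, 'p, 'n) cat_functor \<Rightarrow> 'm \<Rightarrow> bool" where
  "cartesian p f \<longleftrightarrow>
     f \<in> Mor (Src p) \<and>
     (\<forall>h \<in> Mor (Src p). \<forall>g \<in> Mor (Tgt p).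
        tg (Src p) h = tg (Src p) f \<and>
        sc (Tgt p) g = omap p (sc (Src p) h) \<and> tg (Tgt p) g = omap p (sc (Src p) f) \<and>
        cmp (Tgt p) (amap p f) g = amap p h \<longrightarrow>
        (\<exists>!k. k \<in> Hom (Src p) (sc (Src p) h) (sc (Src p) f) \<and>
              cmp (Src p) f k = h \<and> amap p k = g))"

definition opcartesian :: "('o, 'm, 'p, 'n) cat_functor \<Rightarrow> 'm \<Rightarrow> bool" where
  "opcartesian p f \<longleftrightarrow>
     f \<in> Mor (Src p) \<and>
     (\<forall>h \<in> Mor (Src p). \<forall>g \<in> Mor (Tgt p).
        sc (Src p) h = sc (Src p) f \<and>
        sc (Tgt p) g = omap p (tg (Src p) f) \<and> tg (Tgt p) g = omap p (tg (Src p) h) \<and>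
        cmp (Tgt p) g (amap p f) = amap p h \<longrightarrow>
        (\<exists>!k. k \<in> Hom (Src p) (tg (Src p) f) (tg (Src p) h) \<and>
              cmp (Src p) k f = h \<and> amap p k = g))"

definition fibration :: "('o, 'm, 'p, 'n) cat_functor \<Rightarrow> bool" where
  "fibration p \<longleftrightarrow>
     is_functor p \<and>
     (\<forall>e \<in> Ob (Src p). \<forall>u \<in> Mor (Tgt p). tg (Tgt p) u = omap p e \<longrightarrow>
        (\<exists>f. cartesian p f \<and> tg (Src p) f = e \<and> amap p f = u))"

definition opfibration :: "('o, 'm, 'p, 'n) cat_functor \<Rightarrow> bool" where
  "opfibration p \<longleftrightarrow>
     is_functor p \<and>
     (\<forall>e \<in> Ob (Src p). \<forall>u \<in> Mor (Tgt p). sc (Tgt p) u = omap p e \<longrightarrow>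
        (\<exists>f. opcartesian p f \<and> sc (Src p) f = e \<and> amap p f = u))"

definition bifibration :: "('o, 'm, 'p, 'n) cat_functor \<Rightarrow> bool" where
  "bifibration p \<longleftrightarrow> fibration p \<and> opfibration p"

definition morphism_of_fibrations ::
  "('o, 'm, 'p, 'n) cat_functor \<Rightarrow> ('o', 'm', 'p', 'n') cat_functor
     \<Rightarrow> ('o, 'm, 'o', 'm') cat_functor \<Rightarrow> ('p, 'n, 'p', 'n') cat_functor \<Rightarrow> bool" where
  "morphism_of_fibrations p q H K \<longleftrightarrow>
     fibration p \<and> fibration q \<and> is_functor H \<and> is_functor K \<and>
     Src H = Src p \<and> Tgt H = Src q \<and> Src K = Tgt p \<and> Tgt K = Tgt q \<and>
     comp_functor q H = comp_functor K p \<and>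
     (\<forall>f. cartesian p f \<longrightarrow> cartesian q (amap H f))"


section \<open>Riguet congruences and generalized congruences\<close>

text \<open>
  \<open>rfl \<Phi> a b a' b'\<close> is the component indexed by the matrix with rows \<open>a b\<close> and \<open>a' b'\<close>.
  It is only meaningful if \<open>a, a'\<close> and \<open>b, b'\<close> are related; for other indices
  it is normalized to be empty, so that equal congruences are equal as records.
\<close>

record ('o, 'm) riguet =
  rob :: "('o \<times> 'o) set"
  rfl :: "'o \<Rightarrow> 'o \<Rightarrow> 'o \<Rightarrow> 'o \<Rightarrow> ('m \<times> 'm) set"

definition riguet_congruence :: "('o, 'm) category \<Rightarrow> ('o, 'm) riguet \<Rightarrow> bool" where
  "riguet_congruence C \<Phi> \<longleftrightarrow>
     equiv (Ob C) (rob \<Phi>) \<and>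
     (\<forall>a b a' b'. (a, a') \<in> rob \<Phi> \<and> (b, b') \<in> rob \<Phi> \<longrightarrow>
        rfl \<Phi> a b a' b' \<subseteq> Hom C a b \<times> Hom C a' b') \<and>
     (\<forall>a b a' b'. \<not> ((a, a') \<in> rob \<Phi> \<and> (b, b') \<in> rob \<Phi>) \<longrightarrow> rfl \<Phi> a b a' b' = {}) \<and>
     (\<forall>a b. (a, b) \<in> rob \<Phi> \<longrightarrow> (idn C a, idn C b) \<in> rfl \<Phi> a a b b) \<and>
     (\<forall>a \<in> Ob C. \<forall>b \<in> Ob C. \<forall>f \<in> Hom C a b. (f, f) \<in> rfl \<Phi> a b a b) \<and>
     (\<forall>a b a' b' f f'. (f, f') \<in> rfl \<Phi> a b a' b' \<longrightarrow> (f', f) \<in> rfl \<Phi> a' b' a b) \<and>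
     (\<forall>a b a' b' a'' b'' f f' f''.
        (f, f') \<in> rfl \<Phi> a b a' b' \<and> (f', f'') \<in> rfl \<Phi> a' b' a'' b'' \<longrightarrow>
        (f, f'') \<in> rfl \<Phi> a b a'' b'') \<and>
     (\<forall>a b c a' b' c' f f' g g'.
        (f, f') \<in> rfl \<Phi> a b a' b' \<and> (g, g') \<in> rfl \<Phi> b c b' c' \<longrightarrow>
        (cmp C g f, cmp C g' f') \<in> rfl \<Phi> a c a' c') \<and>
     (\<forall>a b a' b'. (a, a') \<in> rob \<Phi> \<and> (b, b') \<in> rob \<Phi> \<longrightarrow>
        (\<forall>f \<in> Hom C a b. \<exists>f' \<in> Hom C a' b'. (f, f') \<in> rfl \<Phi> a b a' b'))"

definition mor_seqs :: "('o, 'm) category \<Rightarrow> ('o \<times> 'o) set \<Rightarrow> 'm list set" where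
  "mor_seqs C E =
     {fs. fs \<noteq> [] \<and> set fs \<subseteq> Mor C \<and>
          (\<forall>i < length fs - 1. (tg C (fs ! i), sc C (fs ! (i + 1))) \<in> E)}"

record ('o, 'm) gencong =
  gob :: "('o \<times> 'o) set"
  gfl :: "('m list \<times> 'm list) set"

definition generalized_congruence :: "('o, 'm) category \<Rightarrow> ('o, 'm) gencong \<Rightarrow> bool" where
  "generalized_congruence C \<Psi> \<longleftrightarrow>
     equiv (Ob C) (gob \<Psi>) \<and>
     equiv (mor_seqs C (gob \<Psi>)) (gfl \<Psi>) \<and>
     (\<forall>a b. (a, b) \<in> gob \<Psi> \<longrightarrow> ([idn C a], [idn C b]) \<in> gfl \<Psi>) \<and>
     (\<forall>fs gs. (fs, gs) \<in> gfl \<Psi> \<longrightarrow>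
        (sc C (hd fs), sc C (hd gs)) \<in> gob \<Psi> \<and> (tg C (last fs), tg C (last gs)) \<in> gob \<Psi>) \<and>
     (\<forall>f \<in> Mor C. \<forall>g \<in> Mor C. sc C g = tg C f \<longrightarrow> ([f, g], [cmp C g f]) \<in> gfl \<Psi>) \<and>
     (\<forall>fs fs' gs gs'. (fs, fs') \<in> gfl \<Psi> \<and> (gs, gs') \<in> gfl \<Psi> \<and>
        (tg C (last fs), sc C (hd gs)) \<in> gob \<Psi> \<longrightarrow> (fs @ gs, fs' @ gs') \<in> gfl \<Psi>)"

definition gencong_contains_riguet :: "('o, 'm) gencong \<Rightarrow> ('o, 'm) riguet \<Rightarrow> bool" where
  "gencong_contains_riguet \<Psi> \<Phi> \<longleftrightarrow>
     rob \<Phi> \<subseteq> gob \<Psi> \<and>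
     (\<forall>a b a' b' f f'. (f, f') \<in> rfl \<Phi> a b a' b' \<longrightarrow> ([f], [f']) \<in> gfl \<Psi>)"

definition natural_gencong :: "('o, 'm) category \<Rightarrow> ('o, 'm) riguet \<Rightarrow> ('o, 'm) gencong" where
  "natural_gencong C \<Phi> =
     (THE \<Psi>. generalized_congruence C \<Psi> \<and> gencong_contains_riguet \<Psi> \<Phi> \<and>
        (\<forall>\<Psi>'. generalized_congruence C \<Psi>' \<and> gencong_contains_riguet \<Psi>' \<Phi> \<longrightarrow>
           gob \<Psi> \<subseteq> gob \<Psi>' \<and> gfl \<Psi> \<subseteq> gfl \<Psi>'))"


section \<open>The category of U-categories\<close>

text \<open>
  A Grothendieck universe is given as a set \<open>U\<close> together with the membership structure on its
  elements: \<open>elts x\<close> is the set of members of \<open>x \<in> U\<close>, and a set is an element of the universe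
  iff it is \<open>elts x\<close> for some \<open>x \<in> U\<close>. The clauses are extensionality, transitivity, and
  closure under subsets, pairs, power sets, and unions of families indexed by an element of
  \<open>U\<close>. An infinite element is not demanded, so both usual conventions are covered.
\<close>

definition grothendieck_universe :: "('u \<Rightarrow> 'u set) \<Rightarrow> 'u set \<Rightarrow> bool" where
  "grothendieck_universe elts U \<longleftrightarrow>
     U \<noteq> {} \<and>
     inj_on elts U \<and>
     (\<forall>x \<in> U. elts x \<subseteq> U) \<and>
     (\<forall>x \<in> U. \<forall>S \<subseteq> elts x. \<exists>y \<in> U. elts y = S) \<and>
     (\<forall>x \<in> U. \<forall>y \<in> U. \<exists>z \<in> U. elts z = {x, y}) \<and>
     (\<forall>x \<in> U. \<exists>z \<in> U. elts z = {y \<in> U. elts y \<subseteq> elts x}) \<and>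
     (\<forall>i \<in> U. \<forall>x. x ` elts i \<subseteq> U \<longrightarrow> (\<exists>z \<in> U. elts z = (\<Union>j \<in> elts i. elts (x j))))"

text \<open>
  In a U-category the set of objects is a subset of \<open>U\<close> and every hom-set is an element of
  \<open>U\<close>; by transitivity of \<open>U\<close> all morphisms then belong to \<open>U\<close>.
\<close>

definition U_category :: "('u \<Rightarrow> 'u set) \<Rightarrow> 'u set \<Rightarrow> ('u, 'u) category \<Rightarrow> bool" where
  "U_category elts U C \<longleftrightarrow>
     is_category C \<and> Ob C \<subseteq> U \<and>
     (\<forall>a \<in> Ob C. \<forall>b \<in> Ob C. \<exists>h \<in> U. elts h = Hom C a b)"

type_synonym 'u ucat = "('u, 'u) category"
type_synonym 'u ufunctor = "('u, 'u, 'u, 'u) cat_functor"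

definition Cat :: "('u \<Rightarrow> 'u set) \<Rightarrow> 'u set \<Rightarrow> ('u ucat, 'u ufunctor) category" where
  "Cat elts U =
     mk_category
       {C. U_category elts U C}
       {F. is_functor F \<and> U_category elts U (Src F) \<and> U_category elts U (Tgt F)}
       Src Tgt id_functor comp_functor"

definition Cat_full :: "('u \<Rightarrow> 'u set) \<Rightarrow> 'u set \<Rightarrow> ('u ucat, 'u ufunctor) category" where
  "Cat_full elts U = wide_subcategory (Cat elts U) is_full"


section \<open>Categories with a congruence\<close>

text \<open>
  Given \<open>K\<close>, structures \<open>S c s\<close> on its objects and a preservation predicate \<open>P\<close> on its
  morphisms, the category of structured objects \<open>(c, s)\<close>. A morphism \<open>(x, y, f)\<close> records
  its source and target.
\<close>

definition structured_category ::
  "('o, 'm) category \<Rightarrow> ('o \<Rightarrow> 's \<Rightarrow> bool) \<Rightarrow> ('s \<Rightarrow> 's \<Rightarrow> 'm \<Rightarrow> bool)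
     \<Rightarrow> ('o \<times> 's, ('o \<times> 's) \<times> ('o \<times> 's) \<times> 'm) category" where
  "structured_category K S P =
     mk_category
       {(c, s). c \<in> Ob K \<and> S c s}
       {((c, s), (d, t), f). c \<in> Ob K \<and> S c s \<and> d \<in> Ob K \<and> S d t \<and> f \<in> Hom K c d \<and> P s t f}
       (\<lambda>(x, y, f). x)
       (\<lambda>(x, y, f). y)
       (\<lambda>x. (x, x, idn K (fst x)))
       (\<lambda>(y', z, g) (x, y, f). (x, z, cmp K g f))"

definition forgetful ::
  "('o \<times> 's, ('o \<times> 's) \<times> ('o \<times> 's) \<times> 'm) category \<Rightarrow> ('o, 'm) category
     \<Rightarrow> ('o \<times> 's, ('o \<times> 's) \<times> ('o \<times> 's) \<times> 'm, 'o, 'm) cat_functor" where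
  "forgetful C K = mk_functor C K fst (\<lambda>(x, y, f). f)"

definition preserves_riguet ::
  "('o, 'm) riguet \<Rightarrow> ('p, 'n) riguet \<Rightarrow> ('o, 'm, 'p, 'n) cat_functor \<Rightarrow> bool" where
  "preserves_riguet \<Phi> \<Upsilon> F \<longleftrightarrow>
     (\<forall>a b. (a, b) \<in> rob \<Phi> \<longrightarrow> (omap F a, omap F b) \<in> rob \<Upsilon>) \<and>
     (\<forall>a b a' b' f f'. (f, f') \<in> rfl \<Phi> a b a' b' \<longrightarrow>
        (amap F f, amap F f') \<in> rfl \<Upsilon> (omap F a) (omap F b) (omap F a') (omap F b'))"

definition preserves_gencong ::
  "('o, 'm) gencong \<Rightarrow> ('p, 'n) gencong \<Rightarrow> ('o, 'm, 'p, 'n) cat_functor \<Rightarrow> bool" where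
  "preserves_gencong \<Psi> \<Omega> F \<longleftrightarrow>
     (\<forall>a b. (a, b) \<in> gob \<Psi> \<longrightarrow> (omap F a, omap F b) \<in> gob \<Omega>) \<and>
     (\<forall>fs gs. (fs, gs) \<in> gfl \<Psi> \<longrightarrow> (map (amap F) fs, map (amap F) gs) \<in> gfl \<Omega>)"

type_synonym 'u rcobj = "'u ucat \<times> ('u, 'u) riguet"
type_synonym 'u rcmor = "'u rcobj \<times> 'u rcobj \<times> 'u ufunctor"
type_synonym 'u gcobj = "'u ucat \<times> ('u, 'u) gencong"
type_synonym 'u gcmor = "'u gcobj \<times> 'u gcobj \<times> 'u ufunctor"

definition RCCat :: "('u \<Rightarrow> 'u set) \<Rightarrow> 'u set \<Rightarrow> ('u rcobj, 'u rcmor) category" where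
  "RCCat elts U = structured_category (Cat elts U) riguet_congruence preserves_riguet"

definition RCCat_full :: "('u \<Rightarrow> 'u set) \<Rightarrow> 'u set \<Rightarrow> ('u rcobj, 'u rcmor) category" where
  "RCCat_full elts U = wide_subcategory (RCCat elts U) (\<lambda>(x, y, F). is_full F)"

definition GCCat :: "('u \<Rightarrow> 'u set) \<Rightarrow> 'u set \<Rightarrow> ('u gcobj, 'u gcmor) category" where
  "GCCat elts U = structured_category (Cat elts U) generalized_congruence preserves_gencong"

definition U_R ::
  "('u \<Rightarrow> 'u set) \<Rightarrow> 'u set \<Rightarrow> ('u rcobj, 'u rcmor, 'u ucat, 'u ufunctor) cat_functor" where
  "U_R elts U = forgetful (RCCat elts U) (Cat elts U)"

definition U_R_full ::
  "('u \<Rightarrow> 'u set) \<Rightarrow> 'u set \<Rightarrow> ('u rcobj, 'u rcmor, 'u ucat, 'u ufunctor) cat_functor" where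
  "U_R_full elts U = birestriction (U_R elts U) (RCCat_full elts U) (Cat_full elts U)"

definition U_G ::
  "('u \<Rightarrow> 'u set) \<Rightarrow> 'u set \<Rightarrow> ('u gcobj, 'u gcmor, 'u ucat, 'u ufunctor) cat_functor" where
  "U_G elts U = forgetful (GCCat elts U) (Cat elts U)"

definition natural_functor ::
  "('u \<Rightarrow> 'u set) \<Rightarrow> 'u set \<Rightarrow> ('u rcobj, 'u rcmor, 'u gcobj, 'u gcmor) cat_functor" where
  "natural_functor elts U =
     mk_functor (RCCat elts U) (GCCat elts U)
       (\<lambda>(C, \<Phi>). (C, natural_gencong C \<Phi>))
       (\<lambda>((C, \<Phi>), (D, \<Upsilon>), F).
          ((C, natural_gencong C \<Phi>), (D, natural_gencong D \<Upsilon>), F))"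

end

theory Submission
  imports Defs
begin

text \<open>
  Both forgetful functors are of the same kind: objects carry a structure \<open>s\<close>, morphisms
  are the morphisms of a base category that preserve it. For such a functor a morphism
  \<open>f\<close> from \<open>(c, s)\<close> to \<open>(d, t)\<close> is cartesian exactly if \<open>s\<close> is the initial structure along
  \<open>f\<close>: a morphism \<open>g\<close> into \<open>c\<close> preserves structure as soon as \<open>f \<circ> g\<close> does
  (\<open>cartesian_iff_initial_lift\<close>); dually, final structures give opcartesian morphisms. So the
  fibration statements amount to the existence of initial and final structures.

  Both for generalized and for Riguet congruences the initial structure along \<open>F\<close> is the
  inverse image. For generalized congruences this always exists. For Riguet congruences the
  lifting condition (every \<open>f\<close> can be transported along related objects) has to be lifted from
  the target of \<open>F\<close> back to its source, and this is where fullness of \<open>F\<close> is used. Final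
  generalized congruences exist because the axioms are closure conditions: an intersection of
  generalized congruences is one, so the images of the related pairs generate a least one, and
  it is final because inverse images of generalized congruences are generalized congruences.

  The remaining point is that \<open>\<Phi> \<mapsto> \<Phi>\<^sup>\<natural>\<close> commutes with inverse images along full functors
  (\<open>natural_inverse_image_riguet\<close>). This is not formal, since a full \<open>F\<close> may miss objects of
  its target, and a chain of relations in the target could run through those. The remedy is an
  explicit description of \<open>\<Phi>\<^sup>\<natural>\<close>. In a path \<open>f\<^sub>0, f\<^sub>1, ...\<close> whose ends match only up to
  \<open>\<Phi>\<close>, each next arrow can be transported so as to start where the preceding one ends, so
  that the path becomes composable; its composite is unique up to \<open>\<Phi>\<close>, and two paths are related by
  \<open>\<Phi>\<^sup>\<natural>\<close> exactly if their composites are related by \<open>\<Phi>\<close>. Hence \<open>\<Phi>\<^sup>\<natural>\<close> relates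
  one-arrow paths only if \<open>\<Phi>\<close> does. Let \<open>\<Phi>\<close> now live on the target of \<open>F\<close>. A pair of paths in
  the source of \<open>F\<close> with related images can be replaced, within the source, by the pair of composites; these have related
  images as single arrows, so they are related by the inverse image of \<open>\<Phi>\<close> itself.
\<close>

section \<open>Categories and functors built from raw data\<close>

lemma category_axioms:
  assumes "is_category C"
  shows category_sc: "f \<in> Mor C \<Longrightarrow> sc C f \<in> Ob C"
    and category_tg: "f \<in> Mor C \<Longrightarrow> tg C f \<in> Ob C"
    and category_idn: "a \<in> Ob C \<Longrightarrow> idn C a \<in> Mor C" "a \<in> Ob C \<Longrightarrow> sc C (idn C a) = a"
      "a \<in> Ob C \<Longrightarrow> tg C (idn C a) = a"
    and category_cmp: "f \<in> Mor C \<Longrightarrow> g \<in> Mor C \<Longrightarrow> tg C f = sc C g \<Longrightarrow> cmp C g f \<in> Mor C"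
      "f \<in> Mor C \<Longrightarrow> g \<in> Mor C \<Longrightarrow> tg C f = sc C g \<Longrightarrow> sc C (cmp C g f) = sc C f"
      "f \<in> Mor C \<Longrightarrow> g \<in> Mor C \<Longrightarrow> tg C f = sc C g \<Longrightarrow> tg C (cmp C g f) = tg C g"
    and category_unit: "f \<in> Mor C \<Longrightarrow> cmp C f (idn C (sc C f)) = f"
      "f \<in> Mor C \<Longrightarrow> cmp C (idn C (tg C f)) f = f"
    and category_assoc: "f \<in> Mor C \<Longrightarrow> g \<in> Mor C \<Longrightarrow> h \<in> Mor C \<Longrightarrow> tg C f = sc C g \<Longrightarrow>
      tg C g = sc C h \<Longrightarrow> cmp C h (cmp C g f) = cmp C (cmp C h g) f"
  using assms unfolding is_category_def Hom_def PiE_def Pi_def by simp_all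

lemma functor_axioms:
  assumes "is_functor F"
  shows functor_category: "is_category (Src F)" "is_category (Tgt F)"
    and functor_omap: "a \<in> Ob (Src F) \<Longrightarrow> omap F a \<in> Ob (Tgt F)"
    and functor_amap: "f \<in> Mor (Src F) \<Longrightarrow> amap F f \<in> Mor (Tgt F)"
      "f \<in> Mor (Src F) \<Longrightarrow> sc (Tgt F) (amap F f) = omap F (sc (Src F) f)"
      "f \<in> Mor (Src F) \<Longrightarrow> tg (Tgt F) (amap F f) = omap F (tg (Src F) f)"
    and functor_idn: "a \<in> Ob (Src F) \<Longrightarrow> amap F (idn (Src F) a) = idn (Tgt F) (omap F a)"
    and functor_cmp: "f \<in> Mor (Src F) \<Longrightarrow> g \<in> Mor (Src F) \<Longrightarrow> tg (Src F) f = sc (Src F) g \<Longrightarrow>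
      amap F (cmp (Src F) g f) = cmp (Tgt F) (amap F g) (amap F f)"
    and functor_extensional: "omap F \<in> extensional (Ob (Src F))"
      "amap F \<in> extensional (Mor (Src F))"
  using assms unfolding is_functor_def Hom_def PiE_def Pi_def by simp_all

lemma mk_category_simps [simp]:
  "Ob (mk_category A M s t i c) = A" "Mor (mk_category A M s t i c) = M"
  "f \<in> M \<Longrightarrow> sc (mk_category A M s t i c) f = s f"
  "f \<in> M \<Longrightarrow> tg (mk_category A M s t i c) f = t f"
  "a \<in> A \<Longrightarrow> idn (mk_category A M s t i c) a = i a"
  "f \<in> M \<Longrightarrow> g \<in> M \<Longrightarrow> t f = s g \<Longrightarrow> cmp (mk_category A M s t i c) g f = c g f"
  by (simp_all add: mk_category_def)

lemma mk_category_is_category: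
  assumes "\<And>f. f \<in> M \<Longrightarrow> s f \<in> A \<and> t f \<in> A"
    and "\<And>a. a \<in> A \<Longrightarrow> i a \<in> M \<and> s (i a) = a \<and> t (i a) = a"
    and cl: "\<And>f g. f \<in> M \<Longrightarrow> g \<in> M \<Longrightarrow> t f = s g \<Longrightarrow>
      c g f \<in> M \<and> s (c g f) = s f \<and> t (c g f) = t g"
    and "\<And>f. f \<in> M \<Longrightarrow> c f (i (s f)) = f \<and> c (i (t f)) f = f"
    and "\<And>f g h. f \<in> M \<Longrightarrow> g \<in> M \<Longrightarrow> h \<in> M \<Longrightarrow> t f = s g \<Longrightarrow> t g = s h \<Longrightarrow>
      c h (c g f) = c (c h g) f"
  shows "is_category (mk_category A M s t i c)"
proof -
  let ?C = "mk_category A M s t i c"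
  have 1: "\<forall>f \<in> M. \<forall>g \<in> M. t f = s g \<longrightarrow> cmp ?C g f = c g f \<and> c g f \<in> M \<and> s (c g f) = s f \<and> t (c g f) = t g"
    using cl by simp
  show ?thesis
    unfolding is_category_def
  proof (intro conjI)
    show "sc ?C \<in> Mor ?C \<rightarrow>\<^sub>E Ob ?C" "tg ?C \<in> Mor ?C \<rightarrow>\<^sub>E Ob ?C" "idn ?C \<in> extensional (Ob ?C)"
      using assms(1,2) by (auto simp: mk_category_def)
    show "\<forall>g f. \<not> (f \<in> Mor ?C \<and> g \<in> Mor ?C \<and> tg ?C f = sc ?C g) \<longrightarrow> cmp ?C g f = undefined"
      by (auto simp: mk_category_def)
  qed (use assms 1 in \<open>auto simp: Hom_def\<close>)
qed

lemma mk_category_cong: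
  assumes "A = A'" "M = M'" "\<And>f. f \<in> M \<Longrightarrow> s f = s' f" "\<And>f. f \<in> M \<Longrightarrow> t f = t' f"
    and "\<And>a. a \<in> A \<Longrightarrow> i a = i' a"
    and "\<And>f g. f \<in> M \<Longrightarrow> g \<in> M \<Longrightarrow> t f = s g \<Longrightarrow> c g f = c' g f"
  shows "mk_category A M s t i c = mk_category A' M' s' t' i' c'"
  using assms unfolding mk_category_def by (auto intro!: restrict_ext ext)

lemma mk_functor_simps [simp]:
  "Src (mk_functor C D h k) = C" "Tgt (mk_functor C D h k) = D"
  "a \<in> Ob C \<Longrightarrow> omap (mk_functor C D h k) a = h a"
  "f \<in> Mor C \<Longrightarrow> amap (mk_functor C D h k) f = k f"
  by (simp_all add: mk_functor_def)

lemma mk_functor_cong: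
  assumes "\<And>a. a \<in> Ob C \<Longrightarrow> h a = h' a" "\<And>f. f \<in> Mor C \<Longrightarrow> k f = k' f"
  shows "mk_functor C D h k = mk_functor C D h' k'"
  using assms unfolding mk_functor_def by (auto intro: restrict_ext)

lemma mk_functor_is_functor:
  assumes "is_category C" "is_category D"
    and "\<And>a. a \<in> Ob C \<Longrightarrow> h a \<in> Ob D"
    and "\<And>f. f \<in> Mor C \<Longrightarrow> k f \<in> Hom D (h (sc C f)) (h (tg C f))"
    and "\<And>a. a \<in> Ob C \<Longrightarrow> k (idn C a) = idn D (h a)"
    and "\<And>f g. f \<in> Mor C \<Longrightarrow> g \<in> Mor C \<Longrightarrow> tg C f = sc C g \<Longrightarrow>
      k (cmp C g f) = cmp D (k g) (k f)"
  shows "is_functor (mk_functor C D h k)"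
  unfolding is_functor_def
  using assms category_axioms[OF assms(1)] by (auto simp: mk_functor_def Hom_def)

lemma functor_eqI:
  assumes "is_functor F" "is_functor G" "Src F = Src G" "Tgt F = Tgt G"
    and "\<And>a. a \<in> Ob (Src F) \<Longrightarrow> omap F a = omap G a"
    and "\<And>f. f \<in> Mor (Src F) \<Longrightarrow> amap F f = amap G f"
  shows "F = G"
proof (rule cat_functor.equality)
  show "omap F = omap G"
    using functor_extensional(1)[OF assms(1)] functor_extensional(1)[OF assms(2)] assms(3,5)
    by (auto intro: extensionalityI)
  show "amap F = amap G"
    using functor_extensional(2)[OF assms(1)] functor_extensional(2)[OF assms(2)] assms(3,6)
    by (auto intro: extensionalityI)
qed (use assms in auto)

lemma id_functor_simps [simp]:
  "Src (id_functor C) = C" "Tgt (id_functor C) = C"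
  "a \<in> Ob C \<Longrightarrow> omap (id_functor C) a = a" "f \<in> Mor C \<Longrightarrow> amap (id_functor C) f = f"
  by (simp_all add: id_functor_def embedding_def)

lemma comp_functor_simps [simp]:
  "Src (comp_functor G F) = Src F" "Tgt (comp_functor G F) = Tgt G"
  "a \<in> Ob (Src F) \<Longrightarrow> omap (comp_functor G F) a = omap G (omap F a)"
  "f \<in> Mor (Src F) \<Longrightarrow> amap (comp_functor G F) f = amap G (amap F f)"
  by (simp_all add: comp_functor_def)

lemma id_functor_is_functor: "is_category C \<Longrightarrow> is_functor (id_functor C)"
  unfolding id_functor_def embedding_def
  by (rule mk_functor_is_functor) (auto simp: Hom_def)

lemma comp_functor_is_functor:
  assumes "is_functor F" "is_functor G" "Tgt F = Src G"
  shows "is_functor (comp_functor G F)"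
  unfolding comp_functor_def
  by (rule mk_functor_is_functor)
    (use functor_axioms[OF assms(1)] functor_axioms[OF assms(2)] assms(3) in \<open>auto simp: Hom_def\<close>)

lemma is_full_id_functor: "is_full (id_functor C)"
  by (auto simp: is_full_def Hom_def)

lemma is_full_comp_functor:
  assumes "is_functor F" "Tgt F = Src G" "is_full F" "is_full G"
  shows "is_full (comp_functor G F)"
  unfolding is_full_def
proof (intro ballI)
  fix a b h
  assume ab: "a \<in> Ob (Src (comp_functor G F))" "b \<in> Ob (Src (comp_functor G F))"
    and h: "h \<in> Hom (Tgt (comp_functor G F)) (omap (comp_functor G F) a) (omap (comp_functor G F) b)"
  have "omap F a \<in> Ob (Src G)" "omap F b \<in> Ob (Src G)"
    using ab functor_omap[OF assms(1)] assms(2) by auto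
  then obtain g where g: "g \<in> Hom (Src G) (omap F a) (omap F b)" "amap G g = h"
    using assms(4) h ab unfolding is_full_def by fastforce
  then obtain f where "f \<in> Hom (Src F) a b" "amap F f = g"
    using assms(2,3) ab unfolding is_full_def by fastforce
  then show "\<exists>f \<in> Hom (Src (comp_functor G F)) a b. amap (comp_functor G F) f = h"
    using g by (auto simp: Hom_def)
qed

lemma wide_subcategory_is_category:
  assumes C: "is_category C" and "\<And>a. a \<in> Ob C \<Longrightarrow> P (idn C a)"
    and "\<And>f g. f \<in> Mor C \<Longrightarrow> g \<in> Mor C \<Longrightarrow> tg C f = sc C g \<Longrightarrow> P f \<Longrightarrow> P g \<Longrightarrow> P (cmp C g f)"
  shows "is_category (wide_subcategory C P)"
  unfolding wide_subcategory_def
  by (rule mk_category_is_category) (use assms category_axioms[OF C] in auto)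

lemma wide_subcategory_simps [simp]:
  "Ob (wide_subcategory C P) = Ob C" "Mor (wide_subcategory C P) = {f \<in> Mor C. P f}"
  "f \<in> Mor C \<Longrightarrow> P f \<Longrightarrow> sc (wide_subcategory C P) f = sc C f"
  "f \<in> Mor C \<Longrightarrow> P f \<Longrightarrow> tg (wide_subcategory C P) f = tg C f"
  "a \<in> Ob C \<Longrightarrow> idn (wide_subcategory C P) a = idn C a"
  "f \<in> Mor C \<Longrightarrow> g \<in> Mor C \<Longrightarrow> P f \<Longrightarrow> P g \<Longrightarrow> tg C f = sc C g \<Longrightarrow>
    cmp (wide_subcategory C P) g f = cmp C g f"
  by (simp_all add: wide_subcategory_def)

lemma Hom_wide_subcategory: "Hom (wide_subcategory C P) a b = {f \<in> Hom C a b. P f}"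
  by (auto simp: Hom_def)

lemma embedding_wide_subcategory_is_functor:
  assumes "is_category C" "is_category (wide_subcategory C P)"
  shows "is_functor (embedding (wide_subcategory C P) C)"
  unfolding embedding_def by (rule mk_functor_is_functor) (use assms in \<open>auto simp: Hom_def\<close>)

lemma Cat_simps [simp]:
  "Ob (Cat elts U) = {C. U_category elts U C}"
  "Mor (Cat elts U) = {F. is_functor F \<and> U_category elts U (Src F) \<and> U_category elts U (Tgt F)}"
  "F \<in> Mor (Cat elts U) \<Longrightarrow> sc (Cat elts U) F = Src F"
  "F \<in> Mor (Cat elts U) \<Longrightarrow> tg (Cat elts U) F = Tgt F"
  "C \<in> Ob (Cat elts U) \<Longrightarrow> idn (Cat elts U) C = id_functor C"
  "F \<in> Mor (Cat elts U) \<Longrightarrow> G \<in> Mor (Cat elts U) \<Longrightarrow> Tgt F = Src G \<Longrightarrow>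
    cmp (Cat elts U) G F = comp_functor G F"
  by (simp_all add: Cat_def)

lemma Hom_Cat: "F \<in> Hom (Cat elts U) C D \<longleftrightarrow>
  is_functor F \<and> U_category elts U C \<and> U_category elts U D \<and> Src F = C \<and> Tgt F = D"
  by (auto simp: Hom_def)

lemma cmp_Cat:
  "F \<in> Hom (Cat elts U) C D \<Longrightarrow> G \<in> Hom (Cat elts U) D E \<Longrightarrow> cmp (Cat elts U) G F = comp_functor G F"
  by (simp add: Hom_Cat)

lemma comp_id_functor:
  assumes "is_functor F"
  shows "comp_functor F (id_functor (Src F)) = F" "comp_functor (id_functor (Tgt F)) F = F"
  using assms functor_omap[OF assms] functor_amap(1)[OF assms] functor_category[OF assms]
  by (auto intro!: functor_eqI[OF comp_functor_is_functor] id_functor_is_functor)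

lemma comp_functor_assoc:
  assumes "is_functor F" "is_functor G" "is_functor H" "Tgt F = Src G" "Tgt G = Src H"
  shows "comp_functor H (comp_functor G F) = comp_functor (comp_functor H G) F"
  using assms functor_omap[OF assms(1)] functor_amap(1)[OF assms(1)]
  by (auto intro!: functor_eqI comp_functor_is_functor)

lemma Cat_is_category: "is_category (Cat elts U)"
  unfolding Cat_def
  by (rule mk_category_is_category)
    (simp_all add: comp_id_functor comp_functor_assoc id_functor_is_functor
      comp_functor_is_functor U_category_def)

lemma Ob_Cat_full: "Ob (Cat_full elts U) = {C. U_category elts U C}"
  by (simp add: Cat_full_def)

lemma Hom_Cat_full: "F \<in> Hom (Cat_full elts U) C D \<longleftrightarrow> F \<in> Hom (Cat elts U) C D \<and> is_full F"
  by (simp add: Cat_full_def Hom_wide_subcategory)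

lemma cmp_Cat_full:
  "F \<in> Hom (Cat_full elts U) C D \<Longrightarrow> G \<in> Hom (Cat_full elts U) D E \<Longrightarrow>
    cmp (Cat_full elts U) G F = comp_functor G F"
  unfolding Hom_Cat_full Hom_Cat by (simp add: Cat_full_def)

lemma Cat_full_is_category: "is_category (Cat_full elts U)"
  unfolding Cat_full_def
  by (rule wide_subcategory_is_category[OF Cat_is_category])
    (auto intro: is_full_id_functor is_full_comp_functor)

section \<open>Fibrations of structured objects\<close>

text \<open>
  Restricting the base and then adding structure is the same as adding structure and then
  restricting. This makes the birestricted forgetful functor of Riguet congruences again a
  forgetful functor of structured objects, now over full functors.
\<close>

lemma wide_subcategory_structured_category:
  "wide_subcategory (structured_category K S P) (\<lambda>(x, y, f). Q f)
    = structured_category (wide_subcategory K Q) S P"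
  unfolding wide_subcategory_def[of "structured_category K S P"]
    structured_category_def[of "wide_subcategory K Q"]
proof (rule mk_category_cong, goal_cases)
  case 2
  show ?case
    unfolding structured_category_def mk_category_simps wide_subcategory_simps Hom_wide_subcategory
    by blast
next
  case (6 f g)
  then obtain x y y' z f' g' where "f = (x, y, f')" "g = (y', z, g')" by (metis prod_cases3)
  with 6 show ?case by (auto simp: structured_category_def Hom_def)
qed (auto simp: structured_category_def)

lemma birestriction_forgetful:
  "birestriction (forgetful (structured_category K S P) K)
      (wide_subcategory (structured_category K S P) (\<lambda>(x, y, f). Q f)) (wide_subcategory K Q)
    = forgetful (structured_category (wide_subcategory K Q) S P) (wide_subcategory K Q)"
  unfolding birestriction_def wide_subcategory_structured_category[symmetric]
  unfolding forgetful_def by (rule mk_functor_cong) auto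

locale structured =
  fixes K :: "('o, 'm) category" and S :: "'o \<Rightarrow> 's \<Rightarrow> bool" and P :: "'s \<Rightarrow> 's \<Rightarrow> 'm \<Rightarrow> bool"
  assumes K: "is_category K"
    and P_idn: "\<And>c s. c \<in> Ob K \<Longrightarrow> S c s \<Longrightarrow> P s s (idn K c)"
    and P_cmp: "\<And>c d e r s t f g. f \<in> Hom K c d \<Longrightarrow> g \<in> Hom K d e \<Longrightarrow>
      S c r \<Longrightarrow> S d s \<Longrightarrow> S e t \<Longrightarrow> P r s f \<Longrightarrow> P s t g \<Longrightarrow> P r t (cmp K g f)"
begin

abbreviation E where "E \<equiv> structured_category K S P"
abbreviation p where "p \<equiv> forgetful E K"

lemma structured_category_Mor [simp]:
  "((c, s), (d, t), f) \<in> Mor E \<longleftrightarrow> f \<in> Hom K c d \<and> S c s \<and> S d t \<and> P s t f"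
  using category_axioms[OF K] by (auto simp: structured_category_def Hom_def)

lemma structured_category_Ob [simp]: "(c, s) \<in> Ob E \<longleftrightarrow> c \<in> Ob K \<and> S c s"
  by (simp add: structured_category_def)

lemma structured_category_simps [simp]:
  "(x, y, f) \<in> Mor E \<Longrightarrow> sc E (x, y, f) = x"
  "(x, y, f) \<in> Mor E \<Longrightarrow> tg E (x, y, f) = y"
  "x \<in> Ob E \<Longrightarrow> idn E x = (x, x, idn K (fst x))"
  "(x, y, f) \<in> Mor E \<Longrightarrow> (y, z, g) \<in> Mor E \<Longrightarrow> cmp E (y, z, g) (x, y, f) = (x, z, cmp K g f)"
  by (simp_all add: structured_category_def)

lemma Mor_cases:
  assumes "h \<in> Mor E"
  obtains c s d t f where "h = ((c, s), (d, t), f)" "f \<in> Hom K c d" "S c s" "S d t" "P s t f"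
    "c \<in> Ob K" "d \<in> Ob K"
  using assms by (auto simp: structured_category_def)

lemma structured_category_is_category: "is_category E"
  unfolding structured_category_def
proof (rule mk_category_is_category, goal_cases)
  case (2 a)
  then show ?case using category_axioms[OF K] P_idn by (auto simp: Hom_def)
next
  case (3 f g)
  then obtain c r d s e t f' g' where *: "f = ((c, r), (d, s), f')" "g = ((d, s), (e, t), g')"
    "f' \<in> Hom K c d" "g' \<in> Hom K d e" "S c r" "S d s" "S e t" "P r s f'" "P s t g'"
    "c \<in> Ob K" "d \<in> Ob K" "e \<in> Ob K"
    by auto
  moreover have "cmp K g' f' \<in> Hom K c e"
    using *(3,4) category_cmp[OF K] by (auto simp: Hom_def)
  ultimately show ?case using P_cmp[of f' c d g' e r s t] by simp
next
  case (4 f)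
  then show ?case using category_axioms[OF K] by (auto simp: Hom_def)
next
  case (5 f g h)
  then show ?case using category_axioms[OF K] by (auto simp: Hom_def)
qed auto

lemma forgetful_simps [simp]:
  "Src p = E" "Tgt p = K" "x \<in> Ob E \<Longrightarrow> omap p x = fst x" "(x, y, f) \<in> Mor E \<Longrightarrow> amap p (x, y, f) = f"
  by (simp_all add: forgetful_def)

lemma forgetful_is_functor: "is_functor p"
  unfolding forgetful_def
proof (rule mk_functor_is_functor[OF structured_category_is_category K], goal_cases)
  case (4 f g)
  then show ?case by (elim Mor_cases) auto
qed (auto elim!: Mor_cases)

text \<open>
  The names follow topological categories: \<open>f\<close> exhibits the structure of its source, respectively
  its target, as the initial, respectively final, one along the underlying morphism.
\<close>

definition initial_lift where
  "initial_lift x y f \<longleftrightarrow> (x, y, f) \<in> Mor E \<and>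
     (\<forall>z g. z \<in> Ob E \<and> g \<in> Hom K (fst z) (fst x) \<and> P (snd z) (snd y) (cmp K f g) \<longrightarrow>
       P (snd z) (snd x) g)"

definition final_lift where
  "final_lift x y f \<longleftrightarrow> (x, y, f) \<in> Mor E \<and>
     (\<forall>z g. z \<in> Ob E \<and> g \<in> Hom K (fst y) (fst z) \<and> P (snd x) (snd z) (cmp K g f) \<longrightarrow>
       P (snd y) (snd z) g)"

lemma initial_liftI:
  assumes "f \<in> Hom K c d" "S c s" "S d t" "P s t f"
    and "\<And>e r g. S e r \<Longrightarrow> g \<in> Hom K e c \<Longrightarrow> P r t (cmp K f g) \<Longrightarrow> P r s g"
  shows "initial_lift (c, s) (d, t) f"
  using assms by (auto simp: initial_lift_def)

lemma initial_liftD: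
  assumes "initial_lift (c, s) (d, t) f" "S e r" "g \<in> Hom K e c" "P r t (cmp K f g)"
  shows "P r s g"
proof -
  have "e \<in> Ob K" using assms(3) category_sc[OF K] by (auto simp: Hom_def)
  then show ?thesis using assms by (force simp: initial_lift_def)
qed

lemma final_liftI:
  assumes "f \<in> Hom K c d" "S c s" "S d t" "P s t f"
    and "\<And>e r g. S e r \<Longrightarrow> g \<in> Hom K d e \<Longrightarrow> P s r (cmp K g f) \<Longrightarrow> P t r g"
  shows "final_lift (c, s) (d, t) f"
  using assms by (auto simp: final_lift_def)

text \<open>
  The factorization demanded of a cartesian morphism is already given in the base, and a morphism
  of structured objects is determined by its underlying morphism; so uniqueness is automatic and
  existence is just preservation of structure.
\<close>

lemma cartesian_iff_initial_lift: "cartesian p (x, y, f) \<longleftrightarrow> initial_lift x y f"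
proof (cases "(x, y, f) \<in> Mor E")
  case True
  obtain c s d t where xy: "x = (c, s)" "y = (d, t)" by (cases x, cases y) auto
  note f = True[unfolded xy]
  show ?thesis
  proof
    assume cart: "cartesian p (x, y, f)"
    have "P r s g" if z: "(e, r) \<in> Ob E" "g \<in> Hom K e c" "P r t (cmp K f g)" for e r g
    proof -
      let ?h = "((e, r), (d, t), cmp K f g)"
      have "cmp K f g \<in> Hom K e d" using f z category_cmp[OF K] by (simp add: Hom_def)
      then have h: "?h \<in> Mor E" using f z by simp
      have cs: "(c, s) \<in> Ob E" using f category_sc[OF K] by (auto simp: Hom_def)
      have "\<exists>!k. k \<in> Hom E (sc E ?h) (sc E (x, y, f)) \<and> cmp E (x, y, f) k = ?h \<and> amap p k = g"
        using cart[unfolded cartesian_def forgetful_simps, THEN conjunct2, rule_format, of ?h g]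
          h True z cs by (simp add: Hom_def[of K] xy del: structured_category_Mor)
      then have "\<exists>k. k \<in> Hom E (e, r) (c, s) \<and> amap p k = g"
        using h True by (auto simp only: xy structured_category_simps)
      then show "P r s g" by (auto simp: Hom_def elim!: Mor_cases)
    qed
    then show "initial_lift x y f" using True by (auto simp: initial_lift_def xy)
  next
    assume "initial_lift x y f"
    then have init: "\<And>e r g. (e, r) \<in> Ob E \<Longrightarrow> g \<in> Hom K e c \<Longrightarrow> P r t (cmp K f g) \<Longrightarrow> P r s g"
      by (force simp: initial_lift_def xy)
    show "cartesian p (x, y, f)"
      unfolding cartesian_def forgetful_simps
    proof (intro conjI ballI impI)
      fix h g
      assume h: "h \<in> Mor E" and g: "g \<in> Mor K"
        and e: "tg E h = tg E (x, y, f) \<and> sc K g = omap p (sc E h) \<and>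
          tg K g = omap p (sc E (x, y, f)) \<and> cmp K (amap p (x, y, f)) g = amap p h"
      from h obtain e r d' t' h' where h': "h = ((e, r), (d', t'), h')" "h' \<in> Hom K e d'"
        "S e r" "P r t' h'" "e \<in> Ob K" by (rule Mor_cases)
      have g': "g \<in> Hom K e c" "h' = cmp K f g" "d' = d" "t' = t"
        using e h g f h' category_sc[OF K] by (auto simp: xy Hom_def)
      let ?k = "((e, r), (c, s), g)"
      have k: "?k \<in> Mor E" using init[of e r g] h' g' f by auto
      show "\<exists>!k. k \<in> Hom E (sc E h) (sc E (x, y, f)) \<and> cmp E (x, y, f) k = h \<and> amap p k = g"
      proof (rule ex1I[of _ ?k])
        show "?k \<in> Hom E (sc E h) (sc E (x, y, f)) \<and> cmp E (x, y, f) ?k = h \<and> amap p ?k = g"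
          using k h f h' g' by (simp add: Hom_def[of E] xy del: structured_category_Mor)
        fix k assume a: "k \<in> Hom E (sc E h) (sc E (x, y, f)) \<and> cmp E (x, y, f) k = h \<and> amap p k = g"
        then have "k \<in> Mor E" by (simp add: Hom_def)
        then show "k = ?k" using a h f h' by (elim Mor_cases) (auto simp: Hom_def[of E] xy)
      qed
    qed fact
  qed
qed (auto simp: cartesian_def initial_lift_def)

lemma opcartesian_if_final_lift:
  assumes "final_lift x y f"
  shows "opcartesian p (x, y, f)"
proof -
  obtain c s d t where xy: "x = (c, s)" "y = (d, t)" by (cases x, cases y) auto
  have F: "(x, y, f) \<in> Mor E" using assms by (simp add: final_lift_def)
  note f = F[unfolded xy]
  have fin: "\<And>e r g. (e, r) \<in> Ob E \<Longrightarrow> g \<in> Hom K d e \<Longrightarrow> P s r (cmp K g f) \<Longrightarrow> P t r g"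
    using assms by (force simp: final_lift_def xy)
  show ?thesis
    unfolding opcartesian_def forgetful_simps
  proof (intro conjI ballI impI)
    fix h g
    assume h: "h \<in> Mor E" and g: "g \<in> Mor K"
      and e: "sc E h = sc E (x, y, f) \<and> sc K g = omap p (tg E (x, y, f)) \<and>
          tg K g = omap p (tg E h) \<and> cmp K g (amap p (x, y, f)) = amap p h"
    from h obtain c' s' e r h' where h': "h = ((c', s'), (e, r), h')" "h' \<in> Hom K c' e"
      "S e r" "P s' r h'" "e \<in> Ob K" by (rule Mor_cases)
    have g': "g \<in> Hom K d e" "h' = cmp K g f" "c' = c" "s' = s"
      using e h g f h' category_tg[OF K] by (auto simp: xy Hom_def)
    let ?k = "((d, t), (e, r), g)"
    have k: "?k \<in> Mor E" using fin[of e r g] h' g' f by auto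
    show "\<exists>!k. k \<in> Hom E (tg E (x, y, f)) (tg E h) \<and> cmp E k (x, y, f) = h \<and> amap p k = g"
    proof (rule ex1I[of _ ?k])
      show "?k \<in> Hom E (tg E (x, y, f)) (tg E h) \<and> cmp E ?k (x, y, f) = h \<and> amap p ?k = g"
        using k h f h' g' by (simp add: Hom_def[of E] xy del: structured_category_Mor)
      fix k assume a: "k \<in> Hom E (tg E (x, y, f)) (tg E h) \<and> cmp E k (x, y, f) = h \<and> amap p k = g"
      then have "k \<in> Mor E" by (simp add: Hom_def)
      then show "k = ?k" using a h f h' by (elim Mor_cases) (auto simp: Hom_def[of E] xy)
    qed
  qed fact
qed

lemma fibration_if_initial_lifts:
  assumes "\<And>c d t f. f \<in> Hom K c d \<Longrightarrow> S d t \<Longrightarrow> \<exists>s. initial_lift (c, s) (d, t) f"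
  shows "fibration p"
  unfolding fibration_def forgetful_simps
proof (intro conjI ballI impI forgetful_is_functor)
  fix y u assume y: "y \<in> Ob E" and u: "u \<in> Mor K" "tg K u = omap p y"
  obtain d t where dt: "y = (d, t)" by (cases y)
  have "u \<in> Hom K (sc K u) d" "S d t" using y u by (auto simp: dt Hom_def)
  then obtain s where s: "initial_lift (sc K u, s) y u" using assms unfolding dt by blast
  then have "((sc K u, s), y, u) \<in> Mor E" by (simp only: initial_lift_def)
  then show "\<exists>f. cartesian p f \<and> tg E f = y \<and> amap p f = u"
    using s by (intro exI[of _ "((sc K u, s), y, u)"])
      (simp only: cartesian_iff_initial_lift structured_category_simps forgetful_simps)
qed

lemma opfibration_if_final_lifts:
  assumes "\<And>c d s f. f \<in> Hom K c d \<Longrightarrow> S c s \<Longrightarrow> \<exists>t. final_lift (c, s) (d, t) f"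
  shows "opfibration p"
  unfolding opfibration_def forgetful_simps
proof (intro conjI ballI impI forgetful_is_functor)
  fix x u assume x: "x \<in> Ob E" and u: "u \<in> Mor K" "sc K u = omap p x"
  obtain c s where cs: "x = (c, s)" by (cases x)
  have "u \<in> Hom K c (tg K u)" "S c s" using x u by (auto simp: cs Hom_def)
  then obtain t where t: "final_lift x (tg K u, t) u" using assms unfolding cs by blast
  then have "(x, (tg K u, t), u) \<in> Mor E" by (simp only: final_lift_def)
  then show "\<exists>f. opcartesian p f \<and> sc E f = x \<and> amap p f = u"
    using t by (intro exI[of _ "(x, (tg K u, t), u)"])
      (simp only: opcartesian_if_final_lift structured_category_simps forgetful_simps)
qed

end

lemma structured_wide_subcategory:
  assumes "structured K S P" "is_category (wide_subcategory K Q)"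
  shows "structured (wide_subcategory K Q) S P"
proof -
  interpret structured K S P by fact
  show ?thesis
  proof
    fix c d e r s t f g
    assume fg: "f \<in> Hom (wide_subcategory K Q) c d" "g \<in> Hom (wide_subcategory K Q) d e"
      and S: "S c r" "S d s" "S e t" "P r s f" "P s t g"
    have "cmp (wide_subcategory K Q) g f = cmp K g f"
      using fg unfolding Hom_wide_subcategory by (simp add: Hom_def)
    then show "P r t (cmp (wide_subcategory K Q) g f)"
      using fg S unfolding Hom_wide_subcategory by (simp add: P_cmp[of f c d g e r s t])
  qed (use assms(2) P_idn in simp_all)
qed

section \<open>Generalized congruences\<close>

text \<open>
  The index-based description of paths is traded for one that is compatible with concatenation
  and with mapping a functor over a path.
\<close>

lemma mor_seqs_successively:
  "fs \<in> mor_seqs C R \<longleftrightarrow>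
     fs \<noteq> [] \<and> set fs \<subseteq> Mor C \<and> successively (\<lambda>f g. (tg C f, sc C g) \<in> R) fs"
  by (auto simp: mor_seqs_def successively_conv_nth)

lemma mor_seqs_append:
  "fs \<in> mor_seqs C R \<Longrightarrow> gs \<in> mor_seqs C R \<Longrightarrow> (tg C (last fs), sc C (hd gs)) \<in> R \<Longrightarrow>
    fs @ gs \<in> mor_seqs C R"
  by (auto simp: mor_seqs_successively successively_append_iff)

lemma mor_seqs_singleton [simp]: "[f] \<in> mor_seqs C R \<longleftrightarrow> f \<in> Mor C"
  by (simp add: mor_seqs_successively)

lemma mor_seqs_mono: "fs \<in> mor_seqs C R \<Longrightarrow> R \<subseteq> R' \<Longrightarrow> fs \<in> mor_seqs C R'"
  by (auto simp: mor_seqs_def)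

lemma mor_seqs_ends:
  assumes "fs \<in> mor_seqs C R"
  shows "fs \<noteq> []" "hd fs \<in> Mor C" "last fs \<in> Mor C" "set fs \<subseteq> Mor C"
  using assms by (auto simp: mor_seqs_def)

lemma gencong_axioms:
  assumes "generalized_congruence C \<Psi>"
  shows gencong_gob: "equiv (Ob C) (gob \<Psi>)"
    and gencong_gfl: "equiv (mor_seqs C (gob \<Psi>)) (gfl \<Psi>)"
    and gencong_idn: "(a, b) \<in> gob \<Psi> \<Longrightarrow> ([idn C a], [idn C b]) \<in> gfl \<Psi>"
    and gencong_ends: "(fs, gs) \<in> gfl \<Psi> \<Longrightarrow> (sc C (hd fs), sc C (hd gs)) \<in> gob \<Psi>"
      "(fs, gs) \<in> gfl \<Psi> \<Longrightarrow> (tg C (last fs), tg C (last gs)) \<in> gob \<Psi>"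
    and gencong_cmp: "f \<in> Mor C \<Longrightarrow> g \<in> Mor C \<Longrightarrow> sc C g = tg C f \<Longrightarrow> ([f, g], [cmp C g f]) \<in> gfl \<Psi>"
    and gencong_append: "(fs, fs') \<in> gfl \<Psi> \<Longrightarrow> (gs, gs') \<in> gfl \<Psi> \<Longrightarrow>
      (tg C (last fs), sc C (hd gs)) \<in> gob \<Psi> \<Longrightarrow> (fs @ gs, fs' @ gs') \<in> gfl \<Psi>"
  using assms unfolding generalized_congruence_def by simp_all

lemma equivD:
  assumes "equiv A R"
  shows "a \<in> A \<Longrightarrow> (a, a) \<in> R" "(a, b) \<in> R \<Longrightarrow> (b, a) \<in> R"
    "(a, b) \<in> R \<Longrightarrow> (b, c) \<in> R \<Longrightarrow> (a, c) \<in> R" "(a, b) \<in> R \<Longrightarrow> a \<in> A" "(a, b) \<in> R \<Longrightarrow> b \<in> A"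
  using assms by (auto simp: equiv_def refl_on_def dest: symD transD)

lemma equiv_onI:
  assumes "\<And>a. a \<in> A \<Longrightarrow> (a, a) \<in> R" "\<And>a b. (a, b) \<in> R \<Longrightarrow> (b, a) \<in> R"
    "\<And>a b c. (a, b) \<in> R \<Longrightarrow> (b, c) \<in> R \<Longrightarrow> (a, c) \<in> R" "\<And>a b. (a, b) \<in> R \<Longrightarrow> a \<in> A"
  shows "equiv A R"
proof (rule equivI)
  show "R \<subseteq> A \<times> A" by (rule subrelI) (blast intro: assms(4) assms(4)[OF assms(2)])
  show "refl_on A R" using assms(1) by (simp add: refl_on_def)
  show "sym R" using assms(2) by (blast intro: symI)
  show "trans R" using assms(3) by (blast intro: transI)
qed

text \<open>
  The second component asks only that the terms of both sequences are morphisms. That the sequences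
  are nonempty and match up to the relation on objects can be read off from their images
  (\<open>map_mor_seqs_iff\<close>).
\<close>

definition inverse_image_gencong where
  "inverse_image_gencong F \<Omega> =
     \<lparr> gob = {(a, b). a \<in> Ob (Src F) \<and> b \<in> Ob (Src F) \<and> (omap F a, omap F b) \<in> gob \<Omega>},
       gfl = {(fs, gs). set fs \<subseteq> Mor (Src F) \<and> set gs \<subseteq> Mor (Src F) \<and>
                (map (amap F) fs, map (amap F) gs) \<in> gfl \<Omega>} \<rparr>"

lemma map_mor_seqs_iff:
  assumes F: "is_functor F" and fs: "set fs \<subseteq> Mor (Src F)"
  shows "map (amap F) fs \<in> mor_seqs (Tgt F) (gob \<Omega>) \<longleftrightarrow>
    fs \<in> mor_seqs (Src F) (gob (inverse_image_gencong F \<Omega>))"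
proof -
  have "successively (\<lambda>f g. (tg (Tgt F) (amap F f), sc (Tgt F) (amap F g)) \<in> gob \<Omega>) fs \<longleftrightarrow>
    successively (\<lambda>f g. (tg (Src F) f, sc (Src F) g) \<in> gob (inverse_image_gencong F \<Omega>)) fs"
    by (rule successively_cong)
      (use fs functor_amap[OF F] category_axioms(1,2)[OF functor_category(1)[OF F]]
        in \<open>auto simp: inverse_image_gencong_def subset_iff\<close>)
  then show ?thesis
    using fs functor_amap(1)[OF F] by (auto simp: mor_seqs_successively successively_map)
qed

lemma inverse_image_generalized_congruence:
  assumes F: "is_functor F" and \<Omega>: "generalized_congruence (Tgt F) \<Omega>"
  shows "generalized_congruence (Src F) (inverse_image_gencong F \<Omega>)"
proof -
  let ?C = "Src F" and ?D = "Tgt F" and ?\<Psi> = "inverse_image_gencong F \<Omega>"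
  note C = category_axioms[OF functor_category(1)[OF F]] and F' = functor_axioms[OF F]
  note ob = equivD[OF gencong_gob[OF \<Omega>]] and fl = equivD[OF gencong_gfl[OF \<Omega>]]
  have gob: "(a, b) \<in> gob ?\<Psi> \<longleftrightarrow> a \<in> Ob ?C \<and> b \<in> Ob ?C \<and> (omap F a, omap F b) \<in> gob \<Omega>" for a b
    by (simp add: inverse_image_gencong_def)
  have gfl: "(fs, gs) \<in> gfl ?\<Psi> \<longleftrightarrow> set fs \<subseteq> Mor ?C \<and> set gs \<subseteq> Mor ?C \<and>
      (map (amap F) fs, map (amap F) gs) \<in> gfl \<Omega>" for fs gs
    by (simp add: inverse_image_gencong_def)
  have seqs: "fs \<in> mor_seqs ?C (gob ?\<Psi>)" "gs \<in> mor_seqs ?C (gob ?\<Psi>)" if "(fs, gs) \<in> gfl ?\<Psi>" for fs gs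
    using that fl(4,5) map_mor_seqs_iff[OF F] unfolding gfl by blast+
  show ?thesis
    unfolding generalized_congruence_def
  proof (intro conjI allI impI ballI)
    show "equiv (Ob ?C) (gob ?\<Psi>)"
      by (rule equiv_onI; unfold gob) (use ob F'(3) in blast)+
    show "equiv (mor_seqs ?C (gob ?\<Psi>)) (gfl ?\<Psi>)"
    proof (rule equiv_onI)
      fix fs assume "fs \<in> mor_seqs ?C (gob ?\<Psi>)"
      then show "(fs, fs) \<in> gfl ?\<Psi>"
        using map_mor_seqs_iff[OF F] mor_seqs_ends(4) fl(1) unfolding gfl by blast
    next
      show "(gs, fs) \<in> gfl ?\<Psi>" if "(fs, gs) \<in> gfl ?\<Psi>" for fs gs
        using that fl(2) unfolding gfl by blast
      show "(fs, hs) \<in> gfl ?\<Psi>" if "(fs, gs) \<in> gfl ?\<Psi>" "(gs, hs) \<in> gfl ?\<Psi>" for fs gs hs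
        using that fl(3) unfolding gfl by blast
    qed (rule seqs(1))
    show "([idn ?C a], [idn ?C b]) \<in> gfl ?\<Psi>" if "(a, b) \<in> gob ?\<Psi>" for a b
      using that C F' gencong_idn[OF \<Omega>] by (simp add: gob gfl)
    show "(sc ?C (hd fs), sc ?C (hd gs)) \<in> gob ?\<Psi>" "(tg ?C (last fs), tg ?C (last gs)) \<in> gob ?\<Psi>"
      if *: "(fs, gs) \<in> gfl ?\<Psi>" for fs gs
      using gencong_ends[OF \<Omega>, of "map (amap F) fs" "map (amap F) gs"] * C F'
        mor_seqs_ends[OF seqs(1)[OF *]] mor_seqs_ends[OF seqs(2)[OF *]]
      by (simp_all add: gob gfl hd_map last_map)
    show "([f, g], [cmp ?C g f]) \<in> gfl ?\<Psi>"
      if "f \<in> Mor ?C" "g \<in> Mor ?C" "sc ?C g = tg ?C f" for f g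
      using that C F' gencong_cmp[OF \<Omega>] by (simp add: gfl)
    show "(fs @ gs, fs' @ gs') \<in> gfl ?\<Psi>"
      if *: "(fs, fs') \<in> gfl ?\<Psi> \<and> (gs, gs') \<in> gfl ?\<Psi> \<and> (tg ?C (last fs), sc ?C (hd gs)) \<in> gob ?\<Psi>"
      for fs fs' gs gs'
    proof -
      have fg: "fs \<in> mor_seqs ?C (gob ?\<Psi>)" "gs \<in> mor_seqs ?C (gob ?\<Psi>)"
        using * seqs by blast+
      have "(tg ?D (last (map (amap F) fs)), sc ?D (hd (map (amap F) gs))) \<in> gob \<Omega>"
        using * F'(5,6) mor_seqs_ends[OF fg(1)] mor_seqs_ends[OF fg(2)] by (simp add: gob hd_map last_map)
      then show ?thesis
        using * gencong_append[OF \<Omega>] by (simp add: gfl)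
    qed
  qed
qed

text \<open>
  In this form preservation can be played off against the minimality of a generated congruence.
\<close>

lemma preserves_gencong_iff_inverse_image:
  assumes "generalized_congruence (Src F) \<Psi>"
  shows "preserves_gencong \<Psi> \<Omega> F \<longleftrightarrow>
    gob \<Psi> \<subseteq> gob (inverse_image_gencong F \<Omega>) \<and> gfl \<Psi> \<subseteq> gfl (inverse_image_gencong F \<Omega>)"
proof -
  have "a \<in> Ob (Src F)" "b \<in> Ob (Src F)" if "(a, b) \<in> gob \<Psi>" for a b
    using that equivD[OF gencong_gob[OF assms]] by blast+
  moreover have "set fs \<subseteq> Mor (Src F)" "set gs \<subseteq> Mor (Src F)" if "(fs, gs) \<in> gfl \<Psi>" for fs gs
    using that equivD[OF gencong_gfl[OF assms]] mor_seqs_ends(4) by blast+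
  ultimately show ?thesis
    unfolding preserves_gencong_def inverse_image_gencong_def by (simp add: subset_iff)
qed

definition generated_gencong where
  "generated_gencong C R T =
     \<lparr> gob = \<Inter> {gob \<Psi> | \<Psi>. generalized_congruence C \<Psi> \<and> R \<subseteq> gob \<Psi> \<and> T \<subseteq> gfl \<Psi>},
       gfl = \<Inter> {gfl \<Psi> | \<Psi>. generalized_congruence C \<Psi> \<and> R \<subseteq> gob \<Psi> \<and> T \<subseteq> gfl \<Psi>} \<rparr>"

text \<open>
  Every set of admissible pairs is contained in this congruence, so the family intersected in
  \<open>generated_gencong\<close> is nonempty; the intersection of the empty family would not be a relation on
  the objects of the category.
\<close>

lemma total_generalized_congruence:
  assumes "is_category C"
  defines "R \<equiv> Ob C \<times> Ob C"
  shows "generalized_congruence C \<lparr> gob = R, gfl = mor_seqs C R \<times> mor_seqs C R \<rparr>"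
  unfolding generalized_congruence_def gencong.simps
proof (intro conjI allI impI ballI)
  note C = category_axioms[OF assms(1)]
  show "equiv (Ob C) R" "equiv (mor_seqs C R) (mor_seqs C R \<times> mor_seqs C R)"
    unfolding R_def by (auto intro!: equiv_onI)
  show "([idn C a], [idn C b]) \<in> mor_seqs C R \<times> mor_seqs C R" if "(a, b) \<in> R" for a b
    using that C by (simp add: R_def)
  show "(sc C (hd fs), sc C (hd gs)) \<in> R" "(tg C (last fs), tg C (last gs)) \<in> R"
    if "(fs, gs) \<in> mor_seqs C R \<times> mor_seqs C R" for fs gs
    using that C(1,2) mor_seqs_ends[of fs C R] mor_seqs_ends[of gs C R] by (simp_all add: R_def)
  show "([f, g], [cmp C g f]) \<in> mor_seqs C R \<times> mor_seqs C R"
    if "f \<in> Mor C" "g \<in> Mor C" "sc C g = tg C f" for f g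
    using that C by (simp add: R_def mor_seqs_successively)
  show "(fs @ gs, fs' @ gs') \<in> mor_seqs C R \<times> mor_seqs C R"
    if *: "(fs, fs') \<in> mor_seqs C R \<times> mor_seqs C R \<and> (gs, gs') \<in> mor_seqs C R \<times> mor_seqs C R \<and>
      (tg C (last fs), sc C (hd gs)) \<in> R" for fs fs' gs gs'
  proof -
    have "(tg C (last fs'), sc C (hd gs')) \<in> R"
      using * C(1,2) mor_seqs_ends[of fs' C R] mor_seqs_ends[of gs' C R] by (simp add: R_def)
    then show ?thesis using * by (simp add: mor_seqs_append)
  qed
qed

lemma generated_gencong_least:
  assumes "generalized_congruence C \<Psi>" "R \<subseteq> gob \<Psi>" "T \<subseteq> gfl \<Psi>"
  shows "gob (generated_gencong C R T) \<subseteq> gob \<Psi>" "gfl (generated_gencong C R T) \<subseteq> gfl \<Psi>"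
  using assms by (auto simp: generated_gencong_def)

lemma generated_gencong_contains:
  "R \<subseteq> gob (generated_gencong C R T)" "T \<subseteq> gfl (generated_gencong C R T)"
  by (auto simp: generated_gencong_def)

text \<open>
  Each axiom is a closure condition, hence inherited by intersections. The domain of the second
  component varies with the first one, but paths for an intersection of relations are exactly the
  common paths (fact \<open>seqs\<close> in the proof).
\<close>

lemma generated_generalized_congruence:
  assumes C: "is_category C" and R: "R \<subseteq> Ob C \<times> Ob C"
    and T: "T \<subseteq> mor_seqs C (Ob C \<times> Ob C) \<times> mor_seqs C (Ob C \<times> Ob C)"
  shows "generalized_congruence C (generated_gencong C R T)"
proof -
  define A where "A = {\<Psi>. generalized_congruence C \<Psi> \<and> R \<subseteq> gob \<Psi> \<and> T \<subseteq> gfl \<Psi>}"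
  let ?G = "generated_gencong C R T"
  have gob: "x \<in> gob ?G \<longleftrightarrow> (\<forall>\<Psi> \<in> A. x \<in> gob \<Psi>)" for x
    by (auto simp: generated_gencong_def A_def)
  have gfl: "x \<in> gfl ?G \<longleftrightarrow> (\<forall>\<Psi> \<in> A. x \<in> gfl \<Psi>)" for x
    by (auto simp: generated_gencong_def A_def)
  have A: "generalized_congruence C \<Psi>" if "\<Psi> \<in> A" for \<Psi> using that by (simp add: A_def)
  obtain \<Psi>\<^sub>0 where \<Psi>\<^sub>0: "\<Psi>\<^sub>0 \<in> A"
    using total_generalized_congruence[OF C] R T by (fastforce simp: A_def)
  have seqs: "fs \<in> mor_seqs C (gob ?G) \<longleftrightarrow> (\<forall>\<Psi> \<in> A. fs \<in> mor_seqs C (gob \<Psi>))" for fs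
    using \<Psi>\<^sub>0 by (auto simp: mor_seqs_def gob)
  show ?thesis
    unfolding generalized_congruence_def
  proof (intro conjI allI impI ballI)
    show "equiv (Ob C) (gob ?G)"
      by (rule equiv_onI)
        (use \<Psi>\<^sub>0 equivD[OF gencong_gob[OF A]] in \<open>unfold gob, blast+\<close>)
    show "equiv (mor_seqs C (gob ?G)) (gfl ?G)"
      by (rule equiv_onI)
        (use equivD[OF gencong_gfl[OF A]] in \<open>unfold gfl seqs, blast+\<close>)
  qed (use gencong_axioms(3-)[OF A] in \<open>unfold gfl gob, blast+\<close>)
qed

lemma gencong_support:
  assumes "generalized_congruence C \<Psi>"
  shows "(a, b) \<in> gob \<Psi> \<Longrightarrow> a \<in> Ob C" "(a, b) \<in> gob \<Psi> \<Longrightarrow> b \<in> Ob C"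
    "(fs, gs) \<in> gfl \<Psi> \<Longrightarrow> set fs \<subseteq> Mor C" "(fs, gs) \<in> gfl \<Psi> \<Longrightarrow> set gs \<subseteq> Mor C"
  using equivD(4,5)[OF gencong_gob[OF assms]] equivD(4,5)[OF gencong_gfl[OF assms]] mor_seqs_ends(4)
  by metis+

text \<open>
  The components of a functor are undefined outside its source, hence the restriction to
  sequences of morphisms of the source.
\<close>

lemma map_amap_comp_functor:
  "set fs \<subseteq> Mor (Src F) \<Longrightarrow> map (amap (comp_functor G F)) fs = map (amap G) (map (amap F) fs)"
  by (simp add: subset_iff)

lemma preserves_gencong_comp_functor:
  assumes "generalized_congruence (Src F) \<Psi>"
  shows "preserves_gencong \<Psi> \<Omega> (comp_functor G F) \<longleftrightarrow>
    (\<forall>a b. (a, b) \<in> gob \<Psi> \<longrightarrow> (omap G (omap F a), omap G (omap F b)) \<in> gob \<Omega>) \<and>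
    (\<forall>fs gs. (fs, gs) \<in> gfl \<Psi> \<longrightarrow>
      (map (amap G) (map (amap F) fs), map (amap G) (map (amap F) gs)) \<in> gfl \<Omega>)"
  unfolding preserves_gencong_def
  using gencong_support[OF assms] map_amap_comp_functor[of _ F G]
  by (simp del: map_map cong: imp_cong)

lemma map_prod_image_subset_iff:
  "map_prod f g ` R \<subseteq> T \<longleftrightarrow> (\<forall>a b. (a, b) \<in> R \<longrightarrow> (f a, g b) \<in> T)"
  by auto

lemma structured_gencong: "structured (Cat elts U) generalized_congruence preserves_gencong"
proof
  fix C D E r s t F G
  assume F: "F \<in> Hom (Cat elts U) C D" "G \<in> Hom (Cat elts U) D E"
    and r: "generalized_congruence C r" and P: "preserves_gencong r s F" "preserves_gencong s t G"
  have "generalized_congruence (Src F) r" using F(1) r by (simp add: Hom_Cat)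
  then show "preserves_gencong r t (cmp (Cat elts U) G F)"
    unfolding cmp_Cat[OF F]
    using P by (simp only: preserves_gencong_comp_functor) (simp add: preserves_gencong_def del: map_map)
next
  fix C s assume C: "C \<in> Ob (Cat elts U)" and s: "generalized_congruence C s"
  have "map (amap (id_functor C)) fs = fs" if "set fs \<subseteq> Mor C" for fs
    using that by (auto intro!: map_idI)
  then show "preserves_gencong s s (idn (Cat elts U) C)"
    using C gencong_support[OF s] by (simp add: preserves_gencong_def)
qed (rule Cat_is_category)

text \<open>
  Preservation by \<open>F \<circ> H\<close> is by definition preservation by \<open>H\<close> of the inverse image along \<open>F\<close>.
\<close>

lemma inverse_image_initial_gencong:
  assumes F: "F \<in> Hom (Cat elts U) C D" and \<Omega>: "generalized_congruence D \<Omega>"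
  shows "structured.initial_lift (Cat elts U) generalized_congruence preserves_gencong
    (C, inverse_image_gencong F \<Omega>) (D, \<Omega>) F"
proof -
  interpret G: structured "Cat elts U" generalized_congruence preserves_gencong
    by (rule structured_gencong)
  have f: "is_functor F" "Src F = C" "Tgt F = D" using F by (auto simp: Hom_Cat)
  note I = inverse_image_generalized_congruence[OF f(1), unfolded f, OF \<Omega>]
  have "preserves_gencong (inverse_image_gencong F \<Omega>) \<Omega> F"
    using preserves_gencong_iff_inverse_image[of F "inverse_image_gencong F \<Omega>"] I f by simp
  moreover have "preserves_gencong \<Xi> (inverse_image_gencong F \<Omega>) H"
    if \<Xi>: "generalized_congruence E \<Xi>" and H: "H \<in> Hom (Cat elts U) E C"
      and P: "preserves_gencong \<Xi> \<Omega> (cmp (Cat elts U) F H)" for E \<Xi> H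
  proof -
    have h: "is_functor H" "Src H = E" "Tgt H = C" using H by (auto simp: Hom_Cat)
    have c: "cmp (Cat elts U) F H = comp_functor F H" using H F by (rule cmp_Cat)
    have "(omap F (omap H a), omap F (omap H b)) \<in> gob \<Omega>" if "(a, b) \<in> gob \<Xi>" for a b
      using P that \<Xi> unfolding c by (simp add: preserves_gencong_comp_functor h)
    moreover have "(map (amap F) (map (amap H) fs), map (amap F) (map (amap H) gs)) \<in> gfl \<Omega>"
      if "(fs, gs) \<in> gfl \<Xi>" for fs gs
      using P that \<Xi> unfolding c by (simp add: preserves_gencong_comp_functor h del: map_map)
    moreover have "set (map (amap H) fs) \<subseteq> Mor C" if "set fs \<subseteq> Mor E" for fs
      using that functor_amap(1)[OF h(1)] h by auto
    ultimately show ?thesis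
      using gencong_support[OF \<Xi>] functor_omap[OF h(1)]
      by (simp add: preserves_gencong_def inverse_image_gencong_def f h del: map_map set_map)
  qed
  ultimately show ?thesis
    using F I \<Omega> by (intro G.initial_liftI)
qed

text \<open>
  If \<open>H \<circ> F\<close> preserves congruences, then the inverse image along \<open>H\<close> is a generalized congruence
  that contains the generating pairs, hence contains the generated one; this says that \<open>H\<close>
  preserves congruences.
\<close>

lemma generated_final_gencong:
  assumes F: "F \<in> Hom (Cat elts U) C D" and \<Psi>: "generalized_congruence C \<Psi>"
  shows "structured.final_lift (Cat elts U) generalized_congruence preserves_gencong (C, \<Psi>)
    (D, generated_gencong D (map_prod (omap F) (omap F) ` gob \<Psi>)
          (map_prod (map (amap F)) (map (amap F)) ` gfl \<Psi>)) F"
    (is "structured.final_lift _ _ _ _ (D, generated_gencong D ?R ?T) _")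
proof -
  interpret G: structured "Cat elts U" generalized_congruence preserves_gencong
    by (rule structured_gencong)
  have f: "is_functor F" "Src F = C" "Tgt F = D" using F by (auto simp: Hom_Cat)
  have D: "is_category D" using functor_category[OF f(1)] f by simp
  note sup = gencong_support[OF \<Psi>]
  have R: "?R \<subseteq> Ob D \<times> Ob D" 
    using sup(1,2) functor_omap[OF f(1)] f by (simp add: map_prod_image_subset_iff)
  let ?\<Theta> = "\<lparr> gob = Ob D \<times> Ob D, gfl = mor_seqs D (Ob D \<times> Ob D) \<times> mor_seqs D (Ob D \<times> Ob D) \<rparr>"
  \<comment> \<open>Paths are sent to paths for the total relation, by comparison with its inverse image.\<close>
  have "gob \<Psi> \<subseteq> gob (inverse_image_gencong F ?\<Theta>)"
    using sup(1,2) functor_omap[OF f(1)] f by (auto simp: inverse_image_gencong_def)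
  then have "map (amap F) fs \<in> mor_seqs D (Ob D \<times> Ob D)" if "fs \<in> mor_seqs C (gob \<Psi>)" for fs
    using map_mor_seqs_iff[OF f(1), of fs ?\<Theta>] mor_seqs_mono[OF that] mor_seqs_ends(4)[OF that] f
    by simp
  then have T: "?T \<subseteq> mor_seqs D (Ob D \<times> Ob D) \<times> mor_seqs D (Ob D \<times> Ob D)"
    using equivD(4,5)[OF gencong_gfl[OF \<Psi>]] by (simp add: map_prod_image_subset_iff)
  let ?G = "generated_gencong D ?R ?T"
  note gen = generated_generalized_congruence[OF D R T]
  have "preserves_gencong \<Psi> ?G F"
    using generated_gencong_contains(1)[of ?R D ?T]
      generated_gencong_contains(2)[where R = ?R and T = ?T and C = D]
    unfolding preserves_gencong_def map_prod_image_subset_iff by simp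
  moreover have "preserves_gencong ?G \<Xi> H"
    if \<Xi>: "generalized_congruence E \<Xi>" and H: "H \<in> Hom (Cat elts U) D E"
      and P: "preserves_gencong \<Psi> \<Xi> (cmp (Cat elts U) H F)" for E \<Xi> H
  proof -
    have h: "is_functor H" "Src H = D" "Tgt H = E" using H by (auto simp: Hom_Cat)
    have c: "cmp (Cat elts U) H F = comp_functor H F" using F H by (rule cmp_Cat)
    note I = inverse_image_generalized_congruence[OF h(1), unfolded h, OF \<Xi>]
    have "(omap H (omap F a), omap H (omap F b)) \<in> gob \<Xi>" if "(a, b) \<in> gob \<Psi>" for a b
      using P that \<Psi> unfolding c by (simp add: preserves_gencong_comp_functor f)
    then have "?R \<subseteq> gob (inverse_image_gencong H \<Xi>)"
      using R by (simp add: map_prod_image_subset_iff inverse_image_gencong_def h)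
    moreover have "(map (amap H) (map (amap F) fs), map (amap H) (map (amap F) gs)) \<in> gfl \<Xi>"
      if "(fs, gs) \<in> gfl \<Psi>" for fs gs
      using P that \<Psi> unfolding c by (simp add: preserves_gencong_comp_functor f del: map_map)
    moreover have "set (map (amap F) fs) \<subseteq> Mor D" if "set fs \<subseteq> Mor C" for fs
      using that functor_amap(1)[OF f(1)] f by auto
    ultimately have "?R \<subseteq> gob (inverse_image_gencong H \<Xi>)" "?T \<subseteq> gfl (inverse_image_gencong H \<Xi>)"
      using sup(3,4) unfolding map_prod_image_subset_iff
      by (simp_all add: inverse_image_gencong_def h del: map_map set_map)
    then show ?thesis
      using preserves_gencong_iff_inverse_image[of H ?G \<Xi>] gen h
        generated_gencong_least[OF I] by simp
  qed
  ultimately show ?thesis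
    using F gen \<Psi> by (intro G.final_liftI)
qed

lemma forgetful_gencong_bifibration: "bifibration (U_G elts U)"
proof -
  interpret G: structured "Cat elts U" generalized_congruence preserves_gencong
    by (rule structured_gencong)
  show ?thesis
    unfolding bifibration_def U_G_def GCCat_def
    using G.fibration_if_initial_lifts G.opfibration_if_final_lifts
      inverse_image_initial_gencong generated_final_gencong by blast
qed

section \<open>The generalized congruence generated by a Riguet congruence\<close>

text \<open>
  The union of all components. A pair of morphisms determines the only component in which it can
  lie (\<open>flow_iff\<close>), so no information is lost, and the four indices can be dropped.
\<close>

definition flow where
  "flow \<Phi> = {(f, f'). \<exists>a b a' b'. (f, f') \<in> rfl \<Phi> a b a' b'}"

text \<open>
  The lifting condition lets a morphism \<open>g\<close> be replaced by a related one that starts at a given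
  object \<open>a\<close> related to the source of \<open>g\<close>. The choice among such morphisms does not matter: any
  two of them are related to each other.
\<close>

definition transport where
  "transport C \<Phi> a g = (SOME g'. (g, g') \<in> flow \<Phi> \<and> sc C g' = a)"

text \<open>
  The recursion runs from the end of the path: the composite of the tail is transported so that it
  starts at the target of the first arrow. Thus the composite starts exactly where the path starts,
  while it ends at an object that is merely related to the end of the path.
\<close>

fun path_composite where
  "path_composite C \<Phi> [] = undefined"
| "path_composite C \<Phi> [f] = f"
| "path_composite C \<Phi> (f # fs) =
     cmp C (transport C \<Phi> (tg C f) (path_composite C \<Phi> fs)) f"

text \<open>
  Paths are identified if their composites are related. This turns out to be the generalized
  congruence generated by \<open>\<Phi>\<close>.
\<close>

definition path_gencong where
  "path_gencong C \<Phi> =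
     \<lparr> gob = rob \<Phi>,
       gfl = {(fs, gs). fs \<in> mor_seqs C (rob \<Phi>) \<and> gs \<in> mor_seqs C (rob \<Phi>) \<and>
         (path_composite C \<Phi> fs, path_composite C \<Phi> gs) \<in> flow \<Phi>} \<rparr>"

locale riguet =
  fixes C :: "('o, 'm) category" and \<Phi> :: "('o, 'm) riguet"
  assumes category: "is_category C" and riguet: "riguet_congruence C \<Phi>"
begin

lemma rob_equiv: "equiv (Ob C) (rob \<Phi>)"
  using riguet by (simp add: riguet_congruence_def)

lemma rfl_Hom:
  assumes "(f, f') \<in> rfl \<Phi> a b a' b'"
  shows "f \<in> Hom C a b" "f' \<in> Hom C a' b'" "(a, a') \<in> rob \<Phi>" "(b, b') \<in> rob \<Phi>"
proof -
  have "\<forall>a b a' b'. \<not> ((a, a') \<in> rob \<Phi> \<and> (b, b') \<in> rob \<Phi>) \<longrightarrow> rfl \<Phi> a b a' b' = {}"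
    using riguet unfolding riguet_congruence_def by (elim conjE)
  then show r: "(a, a') \<in> rob \<Phi>" "(b, b') \<in> rob \<Phi>"
    using assms by (metis empty_iff)+
  have "\<forall>a b a' b'. (a, a') \<in> rob \<Phi> \<and> (b, b') \<in> rob \<Phi> \<longrightarrow>
      rfl \<Phi> a b a' b' \<subseteq> Hom C a b \<times> Hom C a' b'"
    using riguet unfolding riguet_congruence_def by (elim conjE)
  then show "f \<in> Hom C a b" "f' \<in> Hom C a' b'" using assms r by blast+
qed

lemma rfl_axioms:
  shows rfl_idn: "\<And>a b. (a, b) \<in> rob \<Phi> \<Longrightarrow> (idn C a, idn C b) \<in> rfl \<Phi> a a b b"
    and rfl_refl: "\<And>a b f. a \<in> Ob C \<Longrightarrow> b \<in> Ob C \<Longrightarrow> f \<in> Hom C a b \<Longrightarrow> (f, f) \<in> rfl \<Phi> a b a b"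
    and rfl_sym: "\<And>a b a' b' f f'. (f, f') \<in> rfl \<Phi> a b a' b' \<Longrightarrow> (f', f) \<in> rfl \<Phi> a' b' a b"
    and rfl_trans: "\<And>a b a' b' a'' b'' f f' f''. (f, f') \<in> rfl \<Phi> a b a' b' \<Longrightarrow>
      (f', f'') \<in> rfl \<Phi> a' b' a'' b'' \<Longrightarrow> (f, f'') \<in> rfl \<Phi> a b a'' b''"
    and rfl_cmp: "\<And>a b c a' b' c' f f' g g'. (f, f') \<in> rfl \<Phi> a b a' b' \<Longrightarrow>
      (g, g') \<in> rfl \<Phi> b c b' c' \<Longrightarrow> (cmp C g f, cmp C g' f') \<in> rfl \<Phi> a c a' c'"
    and rfl_lift: "\<And>a b a' b' f. (a, a') \<in> rob \<Phi> \<Longrightarrow> (b, b') \<in> rob \<Phi> \<Longrightarrow> f \<in> Hom C a b \<Longrightarrow>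
      \<exists>f' \<in> Hom C a' b'. (f, f') \<in> rfl \<Phi> a b a' b'"
proof -
  note ax = riguet[unfolded riguet_congruence_def, THEN conjunct2, THEN conjunct2, THEN conjunct2]
  show "\<And>a b. (a, b) \<in> rob \<Phi> \<Longrightarrow> (idn C a, idn C b) \<in> rfl \<Phi> a a b b"
    using ax[THEN conjunct1] by blast
  note ax = ax[THEN conjunct2]
  show "\<And>a b f. a \<in> Ob C \<Longrightarrow> b \<in> Ob C \<Longrightarrow> f \<in> Hom C a b \<Longrightarrow> (f, f) \<in> rfl \<Phi> a b a b"
    using ax[THEN conjunct1] by simp
  note ax = ax[THEN conjunct2]
  show "\<And>a b a' b' f f'. (f, f') \<in> rfl \<Phi> a b a' b' \<Longrightarrow> (f', f) \<in> rfl \<Phi> a' b' a b"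
    using ax[THEN conjunct1] by blast
  note ax = ax[THEN conjunct2]
  show "\<And>a b a' b' a'' b'' f f' f''. (f, f') \<in> rfl \<Phi> a b a' b' \<Longrightarrow>
      (f', f'') \<in> rfl \<Phi> a' b' a'' b'' \<Longrightarrow> (f, f'') \<in> rfl \<Phi> a b a'' b''"
    using ax[THEN conjunct1] by blast
  note ax = ax[THEN conjunct2]
  show "\<And>a b c a' b' c' f f' g g'. (f, f') \<in> rfl \<Phi> a b a' b' \<Longrightarrow>
      (g, g') \<in> rfl \<Phi> b c b' c' \<Longrightarrow> (cmp C g f, cmp C g' f') \<in> rfl \<Phi> a c a' c'"
    using ax[THEN conjunct1] by blast
  show "\<And>a b a' b' f. (a, a') \<in> rob \<Phi> \<Longrightarrow> (b, b') \<in> rob \<Phi> \<Longrightarrow> f \<in> Hom C a b \<Longrightarrow>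
      \<exists>f' \<in> Hom C a' b'. (f, f') \<in> rfl \<Phi> a b a' b'"
    using ax[THEN conjunct2] by blast
qed

lemma flow_iff: "(f, f') \<in> flow \<Phi> \<longleftrightarrow> (f, f') \<in> rfl \<Phi> (sc C f) (tg C f) (sc C f') (tg C f')"
proof
  assume "(f, f') \<in> flow \<Phi>"
  then obtain a b a' b' where "(f, f') \<in> rfl \<Phi> a b a' b'" by (auto simp: flow_def)
  with rfl_Hom[OF this] show "(f, f') \<in> rfl \<Phi> (sc C f) (tg C f) (sc C f') (tg C f')"
    by (simp add: Hom_def)
qed (auto simp: flow_def)

lemma flow_ends:
  assumes "(f, f') \<in> flow \<Phi>"
  shows "f \<in> Mor C" "f' \<in> Mor C" "(sc C f, sc C f') \<in> rob \<Phi>" "(tg C f, tg C f') \<in> rob \<Phi>"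
  using rfl_Hom[OF assms[unfolded flow_iff]] by (simp_all add: Hom_def)

lemma flow_refl: "f \<in> Mor C \<Longrightarrow> (f, f) \<in> flow \<Phi>"
  using category_axioms(1,2)[OF category] by (simp add: flow_iff rfl_refl Hom_def)

lemma flow_sym: "(f, f') \<in> flow \<Phi> \<Longrightarrow> (f', f) \<in> flow \<Phi>"
  by (simp add: flow_iff rfl_sym)

lemma flow_trans: "(f, f') \<in> flow \<Phi> \<Longrightarrow> (f', f'') \<in> flow \<Phi> \<Longrightarrow> (f, f'') \<in> flow \<Phi>"
  unfolding flow_iff by (rule rfl_trans)

lemma flow_cmp:
  assumes "(f, f') \<in> flow \<Phi>" "(g, g') \<in> flow \<Phi>" "tg C f = sc C g" "tg C f' = sc C g'"
  shows "(cmp C g f, cmp C g' f') \<in> flow \<Phi>"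
  using rfl_cmp[of f f' "sc C f" "tg C f" "sc C f'" "tg C f'" g g' "tg C g" "tg C g'"] assms
  unfolding flow_iff[of f] flow_iff[of g] by (auto simp: flow_def)

lemma transport:
  assumes "g \<in> Mor C" "(a, sc C g) \<in> rob \<Phi>"
  shows "(g, transport C \<Phi> a g) \<in> flow \<Phi>" "sc C (transport C \<Phi> a g) = a"
proof -
  have "tg C g \<in> Ob C" using category_tg[OF category] assms by blast
  then obtain g' where "g' \<in> Hom C a (tg C g)" "(g, g') \<in> flow \<Phi>"
    using rfl_lift[of "sc C g" a "tg C g" "tg C g" g] assms equivD[OF rob_equiv]
    unfolding flow_def Hom_def by blast
  then have "(g, g') \<in> flow \<Phi> \<and> sc C g' = a" by (simp add: Hom_def)
  then have "(g, transport C \<Phi> a g) \<in> flow \<Phi> \<and> sc C (transport C \<Phi> a g) = a"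
    unfolding transport_def by (rule someI)
  then show "(g, transport C \<Phi> a g) \<in> flow \<Phi>" "sc C (transport C \<Phi> a g) = a" by blast+
qed

lemma cmp_transport:
  assumes "f \<in> Mor C" "g \<in> Mor C" "(tg C f, sc C g) \<in> rob \<Phi>"
  defines "h \<equiv> cmp C (transport C \<Phi> (tg C f) g) f"
  shows "h \<in> Mor C" "sc C h = sc C f" "(tg C g, tg C h) \<in> rob \<Phi>"
proof -
  note t = transport[OF assms(2,3)]
  note c = category_cmp[OF category assms(1) flow_ends(2)[OF t(1)] t(2)[symmetric]]
  show "h \<in> Mor C" "sc C h = sc C f" "(tg C g, tg C h) \<in> rob \<Phi>"
    unfolding h_def using c flow_ends(4)[OF t(1)] by simp_all
qed

text \<open>
  Composition after transport is well defined up to the congruence, whatever morphisms have been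
  chosen for the transport.
\<close>

lemma cmp_transport_flow:
  assumes "(f, f') \<in> flow \<Phi>" "(g, g') \<in> flow \<Phi>" "(tg C f, sc C g) \<in> rob \<Phi>" "(tg C f', sc C g') \<in> rob \<Phi>"
  shows "(cmp C (transport C \<Phi> (tg C f) g) f, cmp C (transport C \<Phi> (tg C f') g') f') \<in> flow \<Phi>"
proof -
  note t = transport[OF flow_ends(1)[OF assms(2)] assms(3)]
  note t' = transport[OF flow_ends(2)[OF assms(2)] assms(4)]
  have "(transport C \<Phi> (tg C f) g, transport C \<Phi> (tg C f') g') \<in> flow \<Phi>"
    using t(1) t'(1) assms(2) flow_sym flow_trans by blast
  then show ?thesis using t(2) t'(2) assms(1) by (intro flow_cmp) simp_all
qed

lemma mor_seqs_Cons:
  "f # fs \<in> mor_seqs C R \<longleftrightarrow>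
     f \<in> Mor C \<and> (fs = [] \<or> fs \<in> mor_seqs C R \<and> (tg C f, sc C (hd fs)) \<in> R)"
  by (cases fs) (auto simp: mor_seqs_successively)

lemma path_composite_Cons:
  "fs \<noteq> [] \<Longrightarrow> path_composite C \<Phi> (f # fs) = cmp C (transport C \<Phi> (tg C f) (path_composite C \<Phi> fs)) f"
  by (cases fs) auto

lemma path_composite:
  "fs \<in> mor_seqs C (rob \<Phi>) \<Longrightarrow> path_composite C \<Phi> fs \<in> Mor C \<and>
     sc C (path_composite C \<Phi> fs) = sc C (hd fs) \<and>
     (tg C (last fs), tg C (path_composite C \<Phi> fs)) \<in> rob \<Phi>"
proof (induction fs)
  case Nil
  then show ?case by (simp add: mor_seqs_def)
next
  case (Cons f fs)
  show ?case
  proof (cases "fs = []")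
    case True
    then show ?thesis
      using Cons.prems category_tg[OF category] equivD(1)[OF rob_equiv] by simp
  next
    case False
    then have fs: "f \<in> Mor C" "fs \<in> mor_seqs C (rob \<Phi>)" "(tg C f, sc C (hd fs)) \<in> rob \<Phi>"
      using Cons.prems by (auto simp: mor_seqs_Cons)
    note IH = Cons.IH[OF fs(2)]
    have "(tg C f, sc C (path_composite C \<Phi> fs)) \<in> rob \<Phi>" using IH fs(3) by simp
    note c = cmp_transport[OF fs(1) conjunct1[OF IH] this]
    have "(tg C (last fs), tg C (cmp C (transport C \<Phi> (tg C f) (path_composite C \<Phi> fs)) f)) \<in> rob \<Phi>"
      using IH c(3) equivD(3)[OF rob_equiv] by blast
    then show ?thesis using c False by (simp add: path_composite_Cons)
  qed
qed

text \<open>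
  By induction on the first path. For a path \<open>f # fs\<close> one has two ways to compose: \<open>f\<close> with the
  transported composite of \<open>fs @ gs\<close>, or the composite of \<open>f # fs\<close> with the transported composite
  of \<open>gs\<close>. In the first, the induction hypothesis and compatibility with composition replace the
  composite of \<open>fs @ gs\<close> by a composite of transported versions of the composites of \<open>fs\<close> and \<open>gs\<close>; associativity then
  yields the second.
\<close>

lemma path_composite_append:
  assumes "fs \<in> mor_seqs C (rob \<Phi>)" "gs \<in> mor_seqs C (rob \<Phi>)" "(tg C (last fs), sc C (hd gs)) \<in> rob \<Phi>"
  defines "F \<equiv> path_composite C \<Phi> fs" and "G \<equiv> path_composite C \<Phi> gs"
  shows "(path_composite C \<Phi> (fs @ gs), cmp C (transport C \<Phi> (tg C F) G) F) \<in> flow \<Phi>"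
  using assms(1,3) unfolding F_def
proof (induction fs)
  case Nil
  then show ?case by (simp add: mor_seqs_def)
next
  case (Cons f fs)
  note ob = equivD[OF rob_equiv]
  note pg = path_composite[OF assms(2), folded G_def]
  have gs: "gs \<noteq> []" using assms(2) mor_seqs_ends by blast
  show ?case
  proof (cases "fs = []")
    case True
    have f: "f \<in> Mor C" "(tg C f, sc C G) \<in> rob \<Phi>" using Cons.prems True pg by auto
    then show ?thesis
      using cmp_transport(1)[OF f(1) _ f(2)] pg True gs
      by (simp add: path_composite_Cons G_def flow_refl)
  next
    case False
    then have fs: "f \<in> Mor C" "fs \<in> mor_seqs C (rob \<Phi>)" "(tg C f, sc C (hd fs)) \<in> rob \<Phi>"
      "(tg C (last fs), sc C (hd gs)) \<in> rob \<Phi>"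
      using Cons.prems by (auto simp: mor_seqs_Cons)
    \<comment> \<open>Both bracketings compare with \<open>G'' \<circ> F' \<circ> f\<close>: \<open>F'\<close> starts where \<open>f\<close> ends and \<open>G''\<close>
      where \<open>F'\<close> ends, whereas \<open>G'\<close>, supplied by the induction hypothesis, starts at the end
      of the untransported composite of \<open>fs\<close>.\<close>
    let ?F = "path_composite C \<Phi> fs"
    define F' where "F' = transport C \<Phi> (tg C f) ?F"
    define G' where "G' = transport C \<Phi> (tg C ?F) G"
    define G'' where "G'' = transport C \<Phi> (tg C F') G"
    have IH: "(path_composite C \<Phi> (fs @ gs), cmp C G' ?F) \<in> flow \<Phi>"
      unfolding G'_def by (rule Cons.IH[OF fs(2,4)])
    note pf = path_composite[OF fs(2)]
    have F': "(?F, F') \<in> flow \<Phi>" "sc C F' = tg C f"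
      unfolding F'_def using transport[of ?F "tg C f"] pf fs(3) by auto
    have tF: "(tg C ?F, sc C G) \<in> rob \<Phi>" using pf pg fs(4) ob by metis
    then have G': "(G, G') \<in> flow \<Phi>" "sc C G' = tg C ?F"
      unfolding G'_def using transport[of G] pg by auto
    have tF': "(tg C F', sc C G) \<in> rob \<Phi>" using tF flow_ends(4)[OF F'(1)] ob by blast
    then have G'': "(G, G'') \<in> flow \<Phi>" "sc C G'' = tg C F'"
      unfolding G''_def using transport[of G] pg by auto
    have comp: "tg C (cmp C F' f) = tg C F'" "cmp C G'' (cmp C F' f) = cmp C (cmp C G'' F') f"
      using category_cmp[OF category] category_assoc[OF category] fs(1) flow_ends(2)[OF F'(1)]
        flow_ends(2)[OF G''(1)] F'(2) G''(2) by simp_all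
    have app: "fs @ gs \<in> mor_seqs C (rob \<Phi>)" using fs assms(2) by (simp add: mor_seqs_append)
    have "fs \<noteq> []" by fact
    then have hd: "hd (fs @ gs) = hd fs" by simp
    have T: "(path_composite C \<Phi> (fs @ gs), transport C \<Phi> (tg C f) (path_composite C \<Phi> (fs @ gs))) \<in> flow \<Phi>"
      "sc C (transport C \<Phi> (tg C f) (path_composite C \<Phi> (fs @ gs))) = tg C f"
      using transport[of "path_composite C \<Phi> (fs @ gs)" "tg C f"] path_composite[OF app] fs(3) hd
      by auto
    have GF: "(cmp C G' ?F, cmp C G'' F') \<in> flow \<Phi>"
      using flow_cmp[OF F'(1), of G' G''] flow_trans[OF flow_sym[OF G'(1)] G''(1)] G' G'' by simp
    have sGF: "sc C (cmp C G'' F') = tg C f"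
      using category_cmp(2)[OF category flow_ends(2)[OF F'(1)] flow_ends(2)[OF G''(1)]] F' G'' by simp
    have "(transport C \<Phi> (tg C f) (path_composite C \<Phi> (fs @ gs)), cmp C G'' F') \<in> flow \<Phi>"
      using T(1) IH GF flow_sym flow_trans by blast
    then have "(cmp C (transport C \<Phi> (tg C f) (path_composite C \<Phi> (fs @ gs))) f,
        cmp C (cmp C G'' F') f) \<in> flow \<Phi>"
      using flow_refl[OF fs(1)] T(2) sGF by (intro flow_cmp) simp_all
    then show ?thesis
      using False comp by (simp add: path_composite_Cons F'_def G''_def)
  qed
qed

text \<open>
  As the kernel of \<open>path_composite\<close> modulo \<open>\<Phi>\<close> this is an equivalence; compatibility with
  concatenation is \<open>path_composite_append\<close> together with \<open>cmp_transport_flow\<close>.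
\<close>

lemma path_gencong_generalized_congruence: "generalized_congruence C (path_gencong C \<Phi>)"
proof -
  let ?\<Psi> = "path_gencong C \<Phi>" and ?c = "path_composite C \<Phi>"
  have gob: "gob ?\<Psi> = rob \<Phi>" by (simp add: path_gencong_def)
  have gfl: "(fs, gs) \<in> gfl ?\<Psi> \<longleftrightarrow> fs \<in> mor_seqs C (rob \<Phi>) \<and> gs \<in> mor_seqs C (rob \<Phi>) \<and>
    (?c fs, ?c gs) \<in> flow \<Phi>" for fs gs by (simp add: path_gencong_def)
  note ob = equivD[OF rob_equiv] and C = category_axioms[OF category]
  show ?thesis
    unfolding generalized_congruence_def gob
  proof (intro conjI allI impI ballI)
    show "equiv (mor_seqs C (rob \<Phi>)) (gfl ?\<Psi>)"
      by (rule equiv_onI; unfold gfl) (use path_composite flow_refl flow_sym flow_trans in blast)+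
    show "([idn C a], [idn C b]) \<in> gfl ?\<Psi>" if "(a, b) \<in> rob \<Phi>" for a b
    proof -
      have "(idn C a, idn C b) \<in> flow \<Phi>" using rfl_idn[OF that] unfolding flow_def by blast
      then show ?thesis using flow_ends(1,2) by (simp add: gfl)
    qed
    show "(sc C (hd fs), sc C (hd gs)) \<in> rob \<Phi>" "(tg C (last fs), tg C (last gs)) \<in> rob \<Phi>"
      if "(fs, gs) \<in> gfl ?\<Psi>" for fs gs
    proof -
      have fg: "fs \<in> mor_seqs C (rob \<Phi>)" "gs \<in> mor_seqs C (rob \<Phi>)" "(?c fs, ?c gs) \<in> flow \<Phi>"
        using that unfolding gfl by blast+
      note e = path_composite[OF fg(1)] path_composite[OF fg(2)] flow_ends(3,4)[OF fg(3)]
      show "(sc C (hd fs), sc C (hd gs)) \<in> rob \<Phi>" using e by simp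
      show "(tg C (last fs), tg C (last gs)) \<in> rob \<Phi>" using e ob(2,3) by blast
    qed
    show "([f, g], [cmp C g f]) \<in> gfl ?\<Psi>"
      if *: "f \<in> Mor C" "g \<in> Mor C" "sc C g = tg C f" for f g
    proof -
      have r: "(tg C f, sc C g) \<in> rob \<Phi>" using *(3) ob(1)[OF C(2)[OF *(1)]] by simp
      note t = transport[OF *(2) r]
      have "(cmp C (transport C \<Phi> (tg C f) g) f, cmp C g f) \<in> flow \<Phi>"
        by (rule flow_cmp[OF flow_refl[OF *(1)] flow_sym[OF t(1)]]) (simp_all only: t(2) *(3))
      moreover have "cmp C g f \<in> Mor C" by (rule C(6)) (use * in simp_all)
      moreover have "[f, g] \<in> mor_seqs C (rob \<Phi>)" using *(1,2) r by (simp add: mor_seqs_successively)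
      ultimately show ?thesis unfolding gfl by simp
    qed
    show "(fs @ gs, fs' @ gs') \<in> gfl ?\<Psi>"
      if *: "(fs, fs') \<in> gfl ?\<Psi> \<and> (gs, gs') \<in> gfl ?\<Psi> \<and> (tg C (last fs), sc C (hd gs)) \<in> rob \<Phi>"
      for fs fs' gs gs'
    proof -
      have s: "fs \<in> mor_seqs C (rob \<Phi>)" "fs' \<in> mor_seqs C (rob \<Phi>)"
        "gs \<in> mor_seqs C (rob \<Phi>)" "gs' \<in> mor_seqs C (rob \<Phi>)"
        and r: "(?c fs, ?c fs') \<in> flow \<Phi>" "(?c gs, ?c gs') \<in> flow \<Phi>"
        and m: "(tg C (last fs), sc C (hd gs)) \<in> rob \<Phi>"
        using * unfolding gfl by blast+
      note e = path_composite[OF s(1)] path_composite[OF s(2)] path_composite[OF s(3)]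
        path_composite[OF s(4)]
      have "(tg C (?c fs), sc C (hd gs)) \<in> rob \<Phi>" using e(1) m ob(2,3) by blast
      then have m1: "(tg C (?c fs), sc C (?c gs)) \<in> rob \<Phi>" using e(3) by simp
      have m2: "(tg C (?c fs'), sc C (?c gs')) \<in> rob \<Phi>"
        using m1 flow_ends(4)[OF r(1)] flow_ends(3)[OF r(2)] ob(2,3) by blast
      then have "(tg C (?c fs'), sc C (hd gs')) \<in> rob \<Phi>" using e(4) by simp
      then have m': "(tg C (last fs'), sc C (hd gs')) \<in> rob \<Phi>" using e(2) ob(3) by blast
      have "(?c (fs @ gs), ?c (fs' @ gs')) \<in> flow \<Phi>"
        using path_composite_append[OF s(1,3) m] path_composite_append[OF s(2,4) m']
          cmp_transport_flow[OF r m1 m2] flow_sym flow_trans by blast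
      then show ?thesis using s m m' by (simp add: gfl mor_seqs_append)
    qed
  qed (rule rob_equiv)
qed

lemma path_gencong_contains: "gencong_contains_riguet (path_gencong C \<Phi>) \<Phi>"
proof -
  have "([f], [f']) \<in> gfl (path_gencong C \<Phi>)" if "(f, f') \<in> flow \<Phi>" for f f'
    using that flow_ends(1,2)[OF that] by (simp add: path_gencong_def)
  moreover have "rob \<Phi> \<subseteq> gob (path_gencong C \<Phi>)" by (simp add: path_gencong_def)
  ultimately show ?thesis
    unfolding gencong_contains_riguet_def flow_def by blast
qed

text \<open>
  Replacing an arrow by a transported one and composing two arrows that match on the nose are moves
  inside every generalized congruence that contains \<open>\<Phi>\<close>, and \<open>path_composite\<close> is the result of
  such moves. Minimality of \<open>path_gencong\<close> follows at once.
\<close>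

lemma path_related_composite:
  assumes \<Psi>: "generalized_congruence C \<Psi>" "gencong_contains_riguet \<Psi> \<Phi>"
  shows "fs \<in> mor_seqs C (rob \<Phi>) \<Longrightarrow> (fs, [path_composite C \<Phi> fs]) \<in> gfl \<Psi>"
proof (induction fs)
  case Nil
  then show ?case by (simp add: mor_seqs_def)
next
  case (Cons f fs)
  note fl = equivD[OF gencong_gfl[OF \<Psi>(1)]]
  have f: "f \<in> Mor C" using Cons.prems by (simp add: mor_seqs_Cons)
  have rf: "([f], [f]) \<in> gfl \<Psi>" using f by (intro fl(1)) simp
  show ?case
  proof (cases "fs = []")
    case True
    then show ?thesis using rf by simp
  next
    case False
    let ?F = "path_composite C \<Phi> fs"
    let ?G = "transport C \<Phi> (tg C f) ?F"
    have fs: "fs \<in> mor_seqs C (rob \<Phi>)" "(tg C f, sc C (hd fs)) \<in> rob \<Phi>"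
      using Cons.prems False by (auto simp: mor_seqs_Cons)
    have t: "(?F, ?G) \<in> flow \<Phi>" "sc C ?G = tg C f"
      using transport[of ?F "tg C f"] path_composite[OF fs(1)] fs(2) by auto
    have "([?F], [?G]) \<in> gfl \<Psi>"
      using t(1) \<Psi>(2) unfolding gencong_contains_riguet_def flow_def by blast
    then have "(fs, [?G]) \<in> gfl \<Psi>" using Cons.IH[OF fs(1)] fl(3) by blast
    moreover have "(tg C (last [f]), sc C (hd fs)) \<in> gob \<Psi>"
      using fs(2) \<Psi>(2) by (auto simp: gencong_contains_riguet_def)
    ultimately have "([f] @ fs, [f] @ [?G]) \<in> gfl \<Psi>"
      by (rule gencong_append[OF \<Psi>(1) rf])
    moreover have "([f, ?G], [cmp C ?G f]) \<in> gfl \<Psi>"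
      using gencong_cmp[OF \<Psi>(1) f flow_ends(2)[OF t(1)] t(2)] .
    ultimately show ?thesis using fl(3) False by (simp add: path_composite_Cons)
  qed
qed

lemma path_gencong_least:
  assumes \<Psi>: "generalized_congruence C \<Psi>" "gencong_contains_riguet \<Psi> \<Phi>"
  shows "gob (path_gencong C \<Phi>) \<subseteq> gob \<Psi>" "gfl (path_gencong C \<Phi>) \<subseteq> gfl \<Psi>"
proof -
  show "gob (path_gencong C \<Phi>) \<subseteq> gob \<Psi>"
    using \<Psi>(2) by (simp add: path_gencong_def gencong_contains_riguet_def)
  show "gfl (path_gencong C \<Phi>) \<subseteq> gfl \<Psi>"
  proof (rule subrelI)
    fix fs gs assume "(fs, gs) \<in> gfl (path_gencong C \<Phi>)"
    then have *: "fs \<in> mor_seqs C (rob \<Phi>)" "gs \<in> mor_seqs C (rob \<Phi>)"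
      "(path_composite C \<Phi> fs, path_composite C \<Phi> gs) \<in> flow \<Phi>"
      by (simp_all add: path_gencong_def)
    have "([path_composite C \<Phi> fs], [path_composite C \<Phi> gs]) \<in> gfl \<Psi>"
      using *(3) \<Psi>(2) unfolding gencong_contains_riguet_def flow_def by blast
    then show "(fs, gs) \<in> gfl \<Psi>"
      using path_related_composite[OF \<Psi> *(1)] path_related_composite[OF \<Psi> *(2)]
        equivD(2,3)[OF gencong_gfl[OF \<Psi>(1)]] by blast
  qed
qed

lemma natural_gencong_eq: "natural_gencong C \<Phi> = path_gencong C \<Phi>"
  unfolding natural_gencong_def
proof (rule the_equality)
  show *: "generalized_congruence C (path_gencong C \<Phi>) \<and>
      gencong_contains_riguet (path_gencong C \<Phi>) \<Phi> \<and>
      (\<forall>\<Psi>'. generalized_congruence C \<Psi>' \<and> gencong_contains_riguet \<Psi>' \<Phi> \<longrightarrow>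
         gob (path_gencong C \<Phi>) \<subseteq> gob \<Psi>' \<and> gfl (path_gencong C \<Phi>) \<subseteq> gfl \<Psi>')"
    using path_gencong_generalized_congruence path_gencong_contains path_gencong_least by blast
  fix \<Psi>
  assume "generalized_congruence C \<Psi> \<and> gencong_contains_riguet \<Psi> \<Phi> \<and>
      (\<forall>\<Psi>'. generalized_congruence C \<Psi>' \<and> gencong_contains_riguet \<Psi>' \<Phi> \<longrightarrow>
         gob \<Psi> \<subseteq> gob \<Psi>' \<and> gfl \<Psi> \<subseteq> gfl \<Psi>')"
  then have "gob \<Psi> = gob (path_gencong C \<Phi>)" "gfl \<Psi> = gfl (path_gencong C \<Phi>)"
    using * by (simp_all add: subset_antisym)
  then show "\<Psi> = path_gencong C \<Phi>" by simp
qed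

text \<open>
  No new relations between single morphisms arise in passing to the generated generalized congruence.
  This is what makes an inverse image along a functor that misses objects computable.
\<close>

lemma natural_singletons: "([f], [g]) \<in> gfl (natural_gencong C \<Phi>) \<longleftrightarrow> (f, g) \<in> flow \<Phi>"
  using flow_ends(1,2)[of f g] by (auto simp: natural_gencong_eq path_gencong_def)

end

lemma riguet_support:
  assumes "is_category C" "riguet_congruence C \<Phi>"
  shows "(a, b) \<in> rob \<Phi> \<Longrightarrow> a \<in> Ob C" "(a, b) \<in> rob \<Phi> \<Longrightarrow> b \<in> Ob C"
    "(f, f') \<in> rfl \<Phi> a b a' b' \<Longrightarrow> f \<in> Hom C a b \<and> a \<in> Ob C \<and> b \<in> Ob C"
    "(f, f') \<in> rfl \<Phi> a b a' b' \<Longrightarrow> f' \<in> Hom C a' b' \<and> a' \<in> Ob C \<and> b' \<in> Ob C"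
proof -
  interpret riguet C \<Phi> by standard fact+
  note ob = equivD(4,5)[OF rob_equiv]
  show "(a, b) \<in> rob \<Phi> \<Longrightarrow> a \<in> Ob C" "(a, b) \<in> rob \<Phi> \<Longrightarrow> b \<in> Ob C"
    using ob by blast+
  show "f \<in> Hom C a b \<and> a \<in> Ob C \<and> b \<in> Ob C" "f' \<in> Hom C a' b' \<and> a' \<in> Ob C \<and> b' \<in> Ob C"
    if "(f, f') \<in> rfl \<Phi> a b a' b'"
    using rfl_Hom[OF that] ob by blast+
qed

section \<open>Inverse images of Riguet congruences\<close>

definition inverse_image_riguet where
  "inverse_image_riguet F \<Upsilon> =
     \<lparr> rob = {(a, b). a \<in> Ob (Src F) \<and> b \<in> Ob (Src F) \<and> (omap F a, omap F b) \<in> rob \<Upsilon>},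
       rfl = (\<lambda>a b a' b'. {(f, f'). f \<in> Hom (Src F) a b \<and> f' \<in> Hom (Src F) a' b' \<and>
         (amap F f, amap F f') \<in> rfl \<Upsilon> (omap F a) (omap F b) (omap F a') (omap F b')}) \<rparr>"

text \<open>
  Only the last condition involves more than \<open>F\<close> being a functor: a transported morphism found
  between images of objects has to come from the source category, as fullness guarantees.
\<close>

lemma inverse_image_riguet_congruence:
  assumes F: "is_functor F" "is_full F" and \<Upsilon>: "riguet_congruence (Tgt F) \<Upsilon>"
  shows "riguet_congruence (Src F) (inverse_image_riguet F \<Upsilon>)"
proof -
  let ?C = "Src F" and ?D = "Tgt F" and ?\<Phi> = "inverse_image_riguet F \<Upsilon>"
  interpret D: riguet ?D \<Upsilon> by standard (use functor_category[OF F(1)] \<Upsilon> in auto)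
  note C = category_axioms[OF functor_category(1)[OF F(1)]] and F' = functor_axioms[OF F(1)]
  note ob = equivD[OF D.rob_equiv]
  have rob: "(a, b) \<in> rob ?\<Phi> \<longleftrightarrow> a \<in> Ob ?C \<and> b \<in> Ob ?C \<and> (omap F a, omap F b) \<in> rob \<Upsilon>" for a b
    by (simp add: inverse_image_riguet_def)
  have rfl: "(f, f') \<in> rfl ?\<Phi> a b a' b' \<longleftrightarrow> f \<in> Hom ?C a b \<and> f' \<in> Hom ?C a' b' \<and>
      (amap F f, amap F f') \<in> rfl \<Upsilon> (omap F a) (omap F b) (omap F a') (omap F b')" for f f' a b a' b'
    by (simp add: inverse_image_riguet_def)
  have Hom: "a \<in> Ob ?C \<and> b \<in> Ob ?C \<and> amap F f \<in> Hom ?D (omap F a) (omap F b)"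
    if "f \<in> Hom ?C a b" for f a b
    using that C(1,2) F'(4-6) by (auto simp: Hom_def)
  show ?thesis
    unfolding riguet_congruence_def
  proof (intro conjI allI impI ballI)
    show "equiv (Ob ?C) (rob ?\<Phi>)"
      by (rule equiv_onI; unfold rob) (use ob F'(3) in blast)+
    show "rfl ?\<Phi> a b a' b' \<subseteq> Hom ?C a b \<times> Hom ?C a' b'" for a b a' b'
      by (auto simp: rfl)
    show "rfl ?\<Phi> a b a' b' = {}" if "\<not> ((a, a') \<in> rob ?\<Phi> \<and> (b, b') \<in> rob ?\<Phi>)" for a b a' b'
    proof -
      have "(f, f') \<notin> rfl ?\<Phi> a b a' b'" for f f'
        using that Hom[of f a b] Hom[of f' a' b'] D.rfl_Hom(3,4) unfolding rfl rob by blast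
      then show ?thesis by auto
    qed
    show "(idn ?C a, idn ?C b) \<in> rfl ?\<Phi> a a b b" if "(a, b) \<in> rob ?\<Phi>" for a b
      using that C(3-5) F'(7) D.rfl_idn unfolding rfl rob by (simp add: Hom_def)
    show "(f, f) \<in> rfl ?\<Phi> a b a b" if "f \<in> Hom ?C a b" for a b f
      using that Hom[OF that] F'(3) D.rfl_refl unfolding rfl by blast
    show "(f', f) \<in> rfl ?\<Phi> a' b' a b" if "(f, f') \<in> rfl ?\<Phi> a b a' b'" for a b a' b' f f'
      using that D.rfl_sym unfolding rfl by blast
    show "(f, f'') \<in> rfl ?\<Phi> a b a'' b''"
      if "(f, f') \<in> rfl ?\<Phi> a b a' b' \<and> (f', f'') \<in> rfl ?\<Phi> a' b' a'' b''"
      for a b a' b' a'' b'' f f' f''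
      using that D.rfl_trans unfolding rfl by blast
    show "(cmp ?C g f, cmp ?C g' f') \<in> rfl ?\<Phi> a c a' c'"
      if "(f, f') \<in> rfl ?\<Phi> a b a' b' \<and> (g, g') \<in> rfl ?\<Phi> b c b' c'" for a b c a' b' c' f f' g g'
    proof -
      have "cmp ?C g f \<in> Hom ?C a c" "cmp ?C g' f' \<in> Hom ?C a' c'"
        "amap F (cmp ?C g f) = cmp ?D (amap F g) (amap F f)"
        "amap F (cmp ?C g' f') = cmp ?D (amap F g') (amap F f')"
        using that C(6-8) F'(8) unfolding rfl by (simp_all add: Hom_def)
      then show ?thesis using that D.rfl_cmp unfolding rfl by simp blast
    qed
    show "\<exists>f' \<in> Hom ?C a' b'. (f, f') \<in> rfl ?\<Phi> a b a' b'"
      if r: "(a, a') \<in> rob ?\<Phi> \<and> (b, b') \<in> rob ?\<Phi>" and f: "f \<in> Hom ?C a b" for a b a' b' f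
    proof -
      obtain g where g: "g \<in> Hom ?D (omap F a') (omap F b')"
        "(amap F f, g) \<in> rfl \<Upsilon> (omap F a) (omap F b) (omap F a') (omap F b')"
        using D.rfl_lift r Hom[OF f] unfolding rob by blast
      then obtain f' where "f' \<in> Hom ?C a' b'" "amap F f' = g"
        using F(2) r unfolding is_full_def rob by blast
      then show ?thesis using f g unfolding rfl by blast
    qed
  qed
qed

lemma structured_riguet: "structured (Cat elts U) riguet_congruence preserves_riguet"
proof
  fix C D E r s t F G
  assume F: "F \<in> Hom (Cat elts U) C D" "G \<in> Hom (Cat elts U) D E"
    and r: "riguet_congruence C r" and P: "preserves_riguet r s F" "preserves_riguet s t G"
  have f: "is_functor F" "Src F = C" using F by (auto simp: Hom_Cat)
  note sup = riguet_support[OF functor_category(1)[OF f(1)], unfolded f(2), OF r]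
  show "preserves_riguet r t (cmp (Cat elts U) G F)"
    unfolding cmp_Cat[OF F] preserves_riguet_def
  proof (intro conjI allI impI)
    show "(omap (comp_functor G F) a, omap (comp_functor G F) b) \<in> rob t" if "(a, b) \<in> rob r" for a b
      using that sup(1,2)[OF that] P f(2) by (simp add: preserves_riguet_def)
    show "(amap (comp_functor G F) f, amap (comp_functor G F) f') \<in> rfl t (omap (comp_functor G F) a)
        (omap (comp_functor G F) b) (omap (comp_functor G F) a') (omap (comp_functor G F) b')"
      if "(f, f') \<in> rfl r a b a' b'" for a b a' b' f f'
      using that sup(3,4)[OF that] P f(2) by (simp add: preserves_riguet_def Hom_def)
  qed
next
  fix C s assume C: "C \<in> Ob (Cat elts U)" and s: "riguet_congruence C s"
  then have "is_category C" by (simp add: U_category_def)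
  note sup = riguet_support[OF this s]
  have id: "idn (Cat elts U) C = id_functor C" using C by simp
  show "preserves_riguet s s (idn (Cat elts U) C)"
    unfolding id preserves_riguet_def
  proof (intro conjI allI impI)
    show "(omap (id_functor C) a, omap (id_functor C) b) \<in> rob s" if "(a, b) \<in> rob s" for a b
      using that sup(1,2)[OF that] by simp
    show "(amap (id_functor C) f, amap (id_functor C) f') \<in> rfl s (omap (id_functor C) a)
        (omap (id_functor C) b) (omap (id_functor C) a') (omap (id_functor C) b')"
      if "(f, f') \<in> rfl s a b a' b'" for a b a' b' f f'
      using that sup(3,4)[OF that] by (simp add: Hom_def)
  qed
qed (rule Cat_is_category)

lemma structured_riguet_full: "structured (Cat_full elts U) riguet_congruence preserves_riguet"
  unfolding Cat_full_def
  by (rule structured_wide_subcategory[OF structured_riguet Cat_full_is_category[unfolded Cat_full_def]])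

lemma inverse_image_initial_riguet:
  assumes F: "F \<in> Hom (Cat_full elts U) C D" and \<Upsilon>: "riguet_congruence D \<Upsilon>"
  shows "structured.initial_lift (Cat_full elts U) riguet_congruence preserves_riguet
    (C, inverse_image_riguet F \<Upsilon>) (D, \<Upsilon>) F"
proof -
  interpret R: structured "Cat_full elts U" riguet_congruence preserves_riguet
    by (rule structured_riguet_full)
  have f: "is_functor F" "is_full F" "Src F = C" "Tgt F = D"
    using F unfolding Hom_Cat_full Hom_Cat by auto
  have I: "riguet_congruence C (inverse_image_riguet F \<Upsilon>)"
    using inverse_image_riguet_congruence[OF f(1,2)] \<Upsilon> f by simp
  have P: "preserves_riguet (inverse_image_riguet F \<Upsilon>) \<Upsilon> F"
    by (auto simp: preserves_riguet_def inverse_image_riguet_def)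
  have "preserves_riguet \<Xi> (inverse_image_riguet F \<Upsilon>) H"
    if \<Xi>: "riguet_congruence E \<Xi>" and H: "H \<in> Hom (Cat_full elts U) E C"
      and P: "preserves_riguet \<Xi> \<Upsilon> (cmp (Cat_full elts U) F H)" for E \<Xi> H
  proof -
    have h: "is_functor H" "Src H = E" "Tgt H = C" using H unfolding Hom_Cat_full Hom_Cat by auto
    note P = P[unfolded cmp_Cat_full[OF H F] preserves_riguet_def]
    note H' = functor_axioms[OF h(1), unfolded h]
    note sup = riguet_support[OF functor_category(1)[OF h(1)], unfolded h(2), OF \<Xi>]
    show ?thesis
      unfolding preserves_riguet_def
    proof (intro conjI allI impI)
      show "(omap H a, omap H b) \<in> rob (inverse_image_riguet F \<Upsilon>)" if "(a, b) \<in> rob \<Xi>" for a b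
        using P[THEN conjunct1, rule_format, OF that] sup(1,2)[OF that] H'(3) h(2)
        by (simp add: inverse_image_riguet_def f(3))
      show "(amap H f, amap H f') \<in> rfl (inverse_image_riguet F \<Upsilon>)
          (omap H a) (omap H b) (omap H a') (omap H b')"
        if "(f, f') \<in> rfl \<Xi> a b a' b'" for a b a' b' f f'
        using P[THEN conjunct2, rule_format, OF that] sup(3,4)[OF that] H'(4-6) h(2)
        by (simp add: inverse_image_riguet_def f(3) Hom_def)
    qed
  qed
  then show ?thesis using F I \<Upsilon> P by (intro R.initial_liftI)
qed

text \<open>
  The identity functor is full, so it is an admissible test morphism: applied to it, initiality says
  that the inverse image is contained in \<open>\<Phi>\<close>. The other inclusion is preservation by \<open>F\<close>.
  Equality of the records uses that components at unrelated indices are empty.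
\<close>

lemma initial_riguet_unique:
  assumes "structured.initial_lift (Cat_full elts U) riguet_congruence preserves_riguet (C, \<Phi>) (D, \<Upsilon>) F"
  shows "\<Phi> = inverse_image_riguet F \<Upsilon>"
proof -
  interpret R: structured "Cat_full elts U" riguet_congruence preserves_riguet
    by (rule structured_riguet_full)
  let ?\<Psi> = "inverse_image_riguet F \<Upsilon>" and ?I = "id_functor C"
  have F: "F \<in> Hom (Cat_full elts U) C D" and \<Phi>: "riguet_congruence C \<Phi>"
    and \<Upsilon>: "riguet_congruence D \<Upsilon>" and P: "preserves_riguet \<Phi> \<Upsilon> F"
    using assms by (simp_all add: R.initial_lift_def)
  have f: "is_functor F" "is_full F" "Src F = C" "Tgt F = D" "C \<in> Ob (Cat elts U)"
    using F unfolding Hom_Cat_full Hom_Cat by auto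
  have C: "is_category C" using functor_category(1)[OF f(1)] f by simp
  have I: "?I \<in> Hom (Cat_full elts U) C C"
    using f(5) C unfolding Hom_Cat_full Hom_Cat by (simp add: id_functor_is_functor is_full_id_functor)
  have \<Psi>: "riguet_congruence C ?\<Psi>" "preserves_riguet ?\<Psi> \<Upsilon> F"
    using inverse_image_initial_riguet[OF F \<Upsilon>] by (simp_all add: R.initial_lift_def)
  have "cmp (Cat_full elts U) F ?I = F"
    using cmp_Cat_full[OF I F] comp_id_functor(1)[OF f(1)] f(3) by simp
  then have *: "preserves_riguet ?\<Psi> \<Phi> ?I"
    using R.initial_liftD[OF assms \<Psi>(1) I] \<Psi>(2) by simp
  note sup = riguet_support[OF C \<Phi>] and sup' = riguet_support[OF C \<Psi>(1)]
  show ?thesis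
  proof (rule riguet.equality)
    show "rob \<Phi> = rob ?\<Psi>"
    proof (rule antisym; rule subrelI)
      show "(a, b) \<in> rob ?\<Psi>" if "(a, b) \<in> rob \<Phi>" for a b
        using that sup(1,2)[OF that] P by (simp add: preserves_riguet_def inverse_image_riguet_def f)
      show "(a, b) \<in> rob \<Phi>" if "(a, b) \<in> rob ?\<Psi>" for a b
        using *[unfolded preserves_riguet_def, THEN conjunct1, rule_format, OF that] sup'(1,2)[OF that]
        by simp
    qed
    show "rfl \<Phi> = rfl ?\<Psi>"
    proof (intro ext antisym; rule subrelI)
      show "(g, g') \<in> rfl ?\<Psi> a b a' b'" if "(g, g') \<in> rfl \<Phi> a b a' b'" for a b a' b' g g'
        using that sup(3,4)[OF that] P by (simp add: preserves_riguet_def inverse_image_riguet_def f)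
      show "(g, g') \<in> rfl \<Phi> a b a' b'" if "(g, g') \<in> rfl ?\<Psi> a b a' b'" for a b a' b' g g'
        using *[unfolded preserves_riguet_def, THEN conjunct2, rule_format, OF that] sup'(3,4)[OF that]
        by (simp add: Hom_def)
    qed
  qed simp
qed

section \<open>Compatibility of generation with inverse images\<close>

text \<open>
  With the inverse image along \<open>F\<close> being a generalized congruence, this gives functoriality of
  \<open>\<natural>\<close> and one half of its compatibility with inverse images.
\<close>

lemma inverse_image_gencong_contains_riguet:
  assumes F: "is_functor F" and \<Phi>: "riguet_congruence (Src F) \<Phi>"
    and P: "preserves_riguet \<Phi> \<Upsilon> F" and \<Omega>: "gencong_contains_riguet \<Omega> \<Upsilon>"
  shows "gencong_contains_riguet (inverse_image_gencong F \<Omega>) \<Phi>"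
  unfolding gencong_contains_riguet_def
proof (intro conjI allI impI subrelI)
  note sup = riguet_support[OF functor_category(1)[OF F] \<Phi>]
  show "(a, b) \<in> gob (inverse_image_gencong F \<Omega>)" if "(a, b) \<in> rob \<Phi>" for a b
    using that sup(1,2)[OF that] P \<Omega>
    by (auto simp: inverse_image_gencong_def preserves_riguet_def gencong_contains_riguet_def)
  show "([f], [f']) \<in> gfl (inverse_image_gencong F \<Omega>)" if "(f, f') \<in> rfl \<Phi> a b a' b'" for a b a' b' f f'
  proof -
    have "([amap F f], [amap F f']) \<in> gfl \<Omega>"
      using that P \<Omega> unfolding preserves_riguet_def gencong_contains_riguet_def by blast
    then show ?thesis using sup(3,4)[OF that] by (simp add: inverse_image_gencong_def Hom_def)
  qed
qed

lemma preserves_natural_gencong: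
  assumes F: "is_functor F" and \<Phi>: "riguet_congruence (Src F) \<Phi>" and \<Upsilon>: "riguet_congruence (Tgt F) \<Upsilon>"
    and P: "preserves_riguet \<Phi> \<Upsilon> F"
  shows "preserves_gencong (natural_gencong (Src F) \<Phi>) (natural_gencong (Tgt F) \<Upsilon>) F"
proof -
  interpret C: riguet "Src F" \<Phi> by standard (use functor_category[OF F] \<Phi> in auto)
  interpret D: riguet "Tgt F" \<Upsilon> by standard (use functor_category[OF F] \<Upsilon> in auto)
  show ?thesis
    unfolding C.natural_gencong_eq D.natural_gencong_eq
      preserves_gencong_iff_inverse_image[OF C.path_gencong_generalized_congruence]
    using C.path_gencong_least[OF
        inverse_image_generalized_congruence[OF F D.path_gencong_generalized_congruence]
        inverse_image_gencong_contains_riguet[OF F \<Phi> P D.path_gencong_contains]]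
    by blast
qed

text \<open>
  The nontrivial inclusion moves both paths to their composites inside the source of \<open>F\<close>, so
  that only images of single morphisms have to be compared in the target. There
  \<open>natural_singletons\<close> applies.
\<close>

lemma natural_inverse_image_riguet:
  assumes F: "is_functor F" "is_full F" and \<Upsilon>: "riguet_congruence (Tgt F) \<Upsilon>"
  shows "natural_gencong (Src F) (inverse_image_riguet F \<Upsilon>)
    = inverse_image_gencong F (natural_gencong (Tgt F) \<Upsilon>)"
proof -
  let ?\<Phi> = "inverse_image_riguet F \<Upsilon>"
  have \<Phi>: "riguet_congruence (Src F) ?\<Phi>" by (rule inverse_image_riguet_congruence[OF F \<Upsilon>])
  have P: "preserves_riguet ?\<Phi> \<Upsilon> F"
    by (auto simp: preserves_riguet_def inverse_image_riguet_def)
  interpret C: riguet "Src F" ?\<Phi> by standard (use functor_category[OF F(1)] \<Phi> in auto)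
  interpret D: riguet "Tgt F" \<Upsilon> by standard (use functor_category[OF F(1)] \<Upsilon> in auto)
  let ?N = "path_gencong (Src F) ?\<Phi>" and ?I = "inverse_image_gencong F (path_gencong (Tgt F) \<Upsilon>)"
  let ?c = "path_composite (Src F) ?\<Phi>"
  note I = inverse_image_generalized_congruence[OF F(1) D.path_gencong_generalized_congruence]
    inverse_image_gencong_contains_riguet[OF F(1) \<Phi> P D.path_gencong_contains]
  have gob: "gob ?I = rob ?\<Phi>"
    by (simp add: inverse_image_gencong_def inverse_image_riguet_def path_gencong_def)
  note fl = equivD[OF gencong_gfl[OF I(1)], unfolded gob]
  have "gfl ?I \<subseteq> gfl ?N"
  proof (rule subrelI)
    fix fs gs assume fg: "(fs, gs) \<in> gfl ?I"
    have s: "fs \<in> mor_seqs (Src F) (rob ?\<Phi>)" "gs \<in> mor_seqs (Src F) (rob ?\<Phi>)"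
      using fl(4,5)[OF fg] by blast+
    have "([?c fs], [?c gs]) \<in> gfl ?I"
      using C.path_related_composite[OF I s(1)] C.path_related_composite[OF I s(2)] fg fl(2,3) by blast
    then have m: "?c fs \<in> Mor (Src F)" "?c gs \<in> Mor (Src F)"
      and "([amap F (?c fs)], [amap F (?c gs)]) \<in> gfl (natural_gencong (Tgt F) \<Upsilon>)"
      by (simp_all add: inverse_image_gencong_def D.natural_gencong_eq)
    then have "(amap F (?c fs), amap F (?c gs)) \<in> flow \<Upsilon>"
      by (simp add: D.natural_singletons)
    then have "(?c fs, ?c gs) \<in> flow ?\<Phi>"
      using m functor_amap(2,3)[OF F(1)]
      unfolding D.flow_iff C.flow_iff by (simp add: inverse_image_riguet_def Hom_def)
    then show "(fs, gs) \<in> gfl ?N" using s by (simp add: path_gencong_def)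
  qed
  then have "gfl ?N = gfl ?I" using C.path_gencong_least(2)[OF I] by (rule subset_antisym[rotated])
  moreover have "gob ?N = gob ?I" using gob by (simp add: path_gencong_def)
  ultimately show ?thesis unfolding C.natural_gencong_eq D.natural_gencong_eq by simp
qed

section \<open>The natural functor is a morphism of fibrations\<close>

lemma U_R_full_eq:
  "U_R_full elts U = forgetful (structured_category (Cat_full elts U) riguet_congruence preserves_riguet) (Cat_full elts U)"
  unfolding U_R_full_def U_R_def RCCat_full_def RCCat_def Cat_full_def by (rule birestriction_forgetful)

lemma RCCat_full_eq:
  "RCCat_full elts U = structured_category (Cat_full elts U) riguet_congruence preserves_riguet"
  unfolding RCCat_full_def RCCat_def Cat_full_def by (rule wide_subcategory_structured_category)

lemma forgetful_riguet_fibration: "fibration (U_R_full elts U)"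
proof -
  interpret R: structured "Cat_full elts U" riguet_congruence preserves_riguet
    by (rule structured_riguet_full)
  show ?thesis
    unfolding U_R_full_eq
    using R.fibration_if_initial_lifts inverse_image_initial_riguet by blast
qed

abbreviation natural_obj where
  "natural_obj \<equiv> \<lambda>(C, \<Phi>). (C, natural_gencong C \<Phi>)"

abbreviation natural_mor where
  "natural_mor \<equiv> \<lambda>((C, \<Phi>), (D, \<Upsilon>), F). ((C, natural_gencong C \<Phi>), (D, natural_gencong D \<Upsilon>), F)"

lemma restriction_natural_functor_eq:
  "restriction (natural_functor elts U) (RCCat_full elts U)
    = mk_functor (RCCat_full elts U) (GCCat elts U) natural_obj natural_mor"
  unfolding restriction_def birestriction_def natural_functor_def mk_functor_simps
  by (rule mk_functor_cong) (simp_all add: RCCat_full_def)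

lemma natural_morphism:
  assumes "F \<in> Hom (Cat elts U) C D" "riguet_congruence C \<Phi>" "riguet_congruence D \<Upsilon>"
    "preserves_riguet \<Phi> \<Upsilon> F"
  shows "((C, natural_gencong C \<Phi>), (D, natural_gencong D \<Upsilon>), F) \<in> Mor (GCCat elts U)"
proof -
  interpret G: structured "Cat elts U" generalized_congruence preserves_gencong
    by (rule structured_gencong)
  have f: "is_functor F" "Src F = C" "Tgt F = D" using assms(1) by (auto simp: Hom_Cat)
  interpret C: riguet C \<Phi> by standard (use functor_category[OF f(1)] f assms in auto)
  interpret D: riguet D \<Upsilon> by standard (use functor_category[OF f(1)] f assms in auto)
  show ?thesis
    using preserves_natural_gencong[OF f(1), of \<Phi> \<Upsilon>] assms f
      C.path_gencong_generalized_congruence D.path_gencong_generalized_congruence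
    by (simp add: GCCat_def C.natural_gencong_eq D.natural_gencong_eq)
qed

lemma natural_functor_is_functor:
  "is_functor (restriction (natural_functor elts U) (RCCat_full elts U))"
proof -
  interpret R: structured "Cat_full elts U" riguet_congruence preserves_riguet
    by (rule structured_riguet_full)
  interpret G: structured "Cat elts U" generalized_congruence preserves_gencong
    by (rule structured_gencong)
  have mor: "\<exists>C \<Phi> D \<Upsilon> F. f = ((C, \<Phi>), (D, \<Upsilon>), F) \<and> F \<in> Hom (Cat_full elts U) C D \<and>
      natural_mor f = (natural_obj (C, \<Phi>), natural_obj (D, \<Upsilon>), F) \<and> natural_mor f \<in> Mor G.E"
    if "f \<in> Mor R.E" for f
    using that by (rule R.Mor_cases)
      (auto simp: Hom_Cat_full simp del: G.structured_category_Mor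
        intro!: natural_morphism[unfolded GCCat_def])
  have ob: "natural_obj x \<in> Ob G.E" if x: "x \<in> Ob R.E" for x
  proof -
    obtain C \<Phi> where C: "x = (C, \<Phi>)" "U_category elts U C" "riguet_congruence C \<Phi>"
      using x by (cases x) (auto simp: Ob_Cat_full)
    interpret C: riguet C \<Phi> by standard (use C in \<open>auto simp: U_category_def\<close>)
    show ?thesis
      using C C.path_gencong_generalized_congruence by (simp add: C.natural_gencong_eq)
  qed
  show ?thesis
    unfolding RCCat_full_eq restriction_natural_functor_eq[unfolded RCCat_full_eq] GCCat_def
  proof (rule mk_functor_is_functor[OF R.structured_category_is_category G.structured_category_is_category])
    fix f assume f: "f \<in> Mor R.E"
    from mor[OF f] obtain C \<Phi> D \<Upsilon> F where *: "f = ((C, \<Phi>), (D, \<Upsilon>), F)"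
      "natural_mor f = (natural_obj (C, \<Phi>), natural_obj (D, \<Upsilon>), F)" "natural_mor f \<in> Mor G.E" by blast
    show "natural_mor f \<in> Hom G.E (natural_obj (sc R.E f)) (natural_obj (tg R.E f))"
      using *(3) f unfolding Hom_def[of G.E] *(2) unfolding *(1)
      by (simp only: R.structured_category_simps G.structured_category_simps mem_Collect_eq simp_thms)
  next
    fix x assume x: "x \<in> Ob R.E"
    show "natural_mor (idn R.E x) = idn G.E (natural_obj x)"
    proof -
      obtain C \<Phi> where C: "x = (C, \<Phi>)" "C \<in> Ob (Cat_full elts U)" using x by (cases x) auto
      then have "idn (Cat_full elts U) C = idn (Cat elts U) C" by (simp add: Cat_full_def)
      then show ?thesis using x ob[OF x] unfolding C(1)
        by (simp del: G.structured_category_Ob R.structured_category_Ob Cat_simps)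
    qed
  next
    fix f g assume f: "f \<in> Mor R.E" "g \<in> Mor R.E" and e: "tg R.E f = sc R.E g"
    from mor[OF f(1)] obtain C \<Phi> D \<Upsilon> F where F: "f = ((C, \<Phi>), (D, \<Upsilon>), F)"
      "F \<in> Hom (Cat_full elts U) C D" "natural_mor f = (natural_obj (C, \<Phi>), natural_obj (D, \<Upsilon>), F)"
      "natural_mor f \<in> Mor G.E" by blast
    from mor[OF f(2)] obtain D' \<Upsilon>' E \<Xi> H where H: "g = ((D', \<Upsilon>'), (E, \<Xi>), H)"
      "H \<in> Hom (Cat_full elts U) D' E" "natural_mor g = (natural_obj (D', \<Upsilon>'), natural_obj (E, \<Xi>), H)"
      "natural_mor g \<in> Mor G.E" by blast
    have D: "D' = D" "\<Upsilon>' = \<Upsilon>"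
      using e f unfolding F(1) H(1) by (simp_all only: R.structured_category_simps prod.inject)
    have "cmp R.E g f = ((C, \<Phi>), (E, \<Xi>), cmp (Cat_full elts U) H F)"
      using f unfolding F(1) H(1) D by (simp only: R.structured_category_simps)
    moreover have "cmp G.E (natural_mor g) (natural_mor f)
        = (natural_obj (C, \<Phi>), natural_obj (E, \<Xi>), cmp (Cat elts U) H F)"
      using F(4) H(4) unfolding F(3) H(3) D by (simp only: G.structured_category_simps)
    moreover have "cmp (Cat_full elts U) H F = cmp (Cat elts U) H F"
      using F(2) H(2) cmp_Cat_full cmp_Cat unfolding D Hom_Cat_full by metis
    ultimately show "natural_mor (cmp R.E g f) = cmp G.E (natural_mor g) (natural_mor f)"
      by simp
  qed (rule ob)
qed

text \<open>
  A cartesian morphism carries the inverse image Riguet congruence on its source; passing to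
  generated congruences yields the inverse image generalized congruence, which is initial.
\<close>

lemma natural_preserves_cartesian:
  assumes "cartesian (U_R_full elts U) m"
  shows "cartesian (U_G elts U) (amap (restriction (natural_functor elts U) (RCCat_full elts U)) m)"
proof -
  interpret R: structured "Cat_full elts U" riguet_congruence preserves_riguet
    by (rule structured_riguet_full)
  interpret G: structured "Cat elts U" generalized_congruence preserves_gencong
    by (rule structured_gencong)
  have M: "m \<in> Mor R.E" using assms unfolding U_R_full_eq cartesian_def R.forgetful_simps by blast
  then obtain C \<Phi> D \<Upsilon> F where m: "m = ((C, \<Phi>), (D, \<Upsilon>), F)" and F: "F \<in> Hom (Cat_full elts U) C D"
    and \<Upsilon>: "riguet_congruence D \<Upsilon>" by (rule R.Mor_cases)
  have f: "is_functor F" "is_full F" "Src F = C" "Tgt F = D" "F \<in> Hom (Cat elts U) C D"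
    using F unfolding Hom_Cat_full Hom_Cat by auto
  have "R.initial_lift (C, \<Phi>) (D, \<Upsilon>) F"
    using assms unfolding U_R_full_eq m R.cartesian_iff_initial_lift .
  then have \<Phi>: "\<Phi> = inverse_image_riguet F \<Upsilon>" by (rule initial_riguet_unique)
  interpret D: riguet D \<Upsilon> by standard (use functor_category[OF f(1)] f \<Upsilon> in auto)
  have "natural_gencong C \<Phi> = inverse_image_gencong F (natural_gencong D \<Upsilon>)"
    using natural_inverse_image_riguet[OF f(1,2)] f \<Upsilon> \<Phi> by simp
  moreover have "generalized_congruence D (natural_gencong D \<Upsilon>)"
    unfolding D.natural_gencong_eq by (rule D.path_gencong_generalized_congruence)
  ultimately have "G.initial_lift (C, natural_gencong C \<Phi>) (D, natural_gencong D \<Upsilon>) F"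
    using inverse_image_initial_gencong[OF f(5)] by simp
  then have "cartesian (U_G elts U) (natural_mor m)"
    unfolding U_G_def GCCat_def m by (simp only: prod.case G.cartesian_iff_initial_lift)
  then show ?thesis
    using M unfolding RCCat_full_eq restriction_natural_functor_eq[unfolded RCCat_full_eq] by (simp only: mk_functor_simps)
qed

lemma natural_over_embedding:
  "comp_functor (U_G elts U) (restriction (natural_functor elts U) (RCCat_full elts U))
    = comp_functor (embedding (Cat_full elts U) (Cat elts U)) (U_R_full elts U)"
proof -
  interpret R: structured "Cat_full elts U" riguet_congruence preserves_riguet
    by (rule structured_riguet_full)
  interpret G: structured "Cat elts U" generalized_congruence preserves_gencong
    by (rule structured_gencong)
  let ?N = "restriction (natural_functor elts U) (RCCat_full elts U)"
  let ?L = "comp_functor (U_G elts U) ?N"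
  note N = natural_functor_is_functor[of elts U]
  have N_simps: "Src ?N = R.E" "Tgt ?N = G.E" "\<And>x. x \<in> Ob R.E \<Longrightarrow> omap ?N x = natural_obj x"
    "\<And>f. f \<in> Mor R.E \<Longrightarrow> amap ?N f = natural_mor f"
    unfolding RCCat_full_eq restriction_natural_functor_eq[unfolded RCCat_full_eq] GCCat_def by simp_all
  note N_ob = functor_omap[OF N, unfolded N_simps(1,2)] and N_mor = functor_amap(1)[OF N, unfolded N_simps(1,2)]
  show ?thesis
    unfolding comp_functor_def U_R_full_eq R.forgetful_simps N_simps U_G_def GCCat_def G.forgetful_simps
      embedding_def mk_functor_simps
  proof (rule mk_functor_cong)
    fix x assume x: "x \<in> Ob R.E"
    obtain C \<Phi> where C: "x = (C, \<Phi>)" by (cases x)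
    have "C \<in> Ob (Cat_full elts U)" using x C by simp
    then show "omap G.p (omap ?N x)
        = omap (mk_functor (Cat_full elts U) (Cat elts U) (\<lambda>a. a) (\<lambda>f. f)) (omap R.p x)"
      using N_ob[OF x] N_simps(3)[OF x] x C by (simp del: G.structured_category_Ob R.structured_category_Ob)
  next
    fix m assume m: "m \<in> Mor R.E"
    then obtain C \<Phi> D \<Upsilon> F where M: "m = ((C, \<Phi>), (D, \<Upsilon>), F)" and F: "F \<in> Hom (Cat_full elts U) C D"
      by (rule R.Mor_cases)
    have "F \<in> Mor (Cat_full elts U)" using F by (simp add: Hom_def)
    then show "amap G.p (amap ?N m)
        = amap (mk_functor (Cat_full elts U) (Cat elts U) (\<lambda>a. a) (\<lambda>f. f)) (amap R.p m)"
      using N_mor[OF m] N_simps(4)[OF m] m M by (simp del: G.structured_category_Mor R.structured_category_Mor)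
  qed
qed

theorem proposition2p60:
  fixes elts :: "'u \<Rightarrow> 'u set" and U :: "'u set"
  assumes "grothendieck_universe elts U"
  shows "fibration (U_R_full elts U)
    \<and> bifibration (U_G elts U)
    \<and> morphism_of_fibrations (U_R_full elts U) (U_G elts U)
         (restriction (natural_functor elts U) (RCCat_full elts U))
         (embedding (Cat_full elts U) (Cat elts U))"
proof -
  have "is_functor (embedding (Cat_full elts U) (Cat elts U))"
    using embedding_wide_subcategory_is_functor[OF Cat_is_category] Cat_full_is_category
    unfolding Cat_full_def by blast
  moreover have "Src (restriction (natural_functor elts U) (RCCat_full elts U)) = Src (U_R_full elts U)"
    "Tgt (restriction (natural_functor elts U) (RCCat_full elts U)) = Src (U_G elts U)"
    "Src (embedding (Cat_full elts U) (Cat elts U)) = Tgt (U_R_full elts U)"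
    "Tgt (embedding (Cat_full elts U) (Cat elts U)) = Tgt (U_G elts U)"
    by (simp_all add: restriction_natural_functor_eq U_R_full_def birestriction_def U_G_def
        forgetful_def embedding_def)
  ultimately show ?thesis
    using forgetful_riguet_fibration[of elts U] forgetful_gencong_bifibration[of elts U]
      natural_functor_is_functor[of elts U] natural_over_embedding[of elts U]
      natural_preserves_cartesian[of elts U]
    unfolding morphism_of_fibrations_def bifibration_def by blast
qed

end
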